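(* For $\varepsilon>0$ let $U_\varepsilon(t)=\varepsilon^2Z(t/\varepsilon^2)$, $t\ge0$. For fixed $0<t_0<T<\infty$, almost surely, $$\lim_{\varepsilon\to0}\ \sup_{t\in[t_0,T]}\big|U_\varepsilon(t)-t\,\bar U\big|=0 .$$
   Context: Graph. A weighted directed graph is a triple $(\mathcal S,\mathcal E,\lambda)$ with $\mathcal S\subset\mathbb R^d$ a countable set of nodes, $\mathcal E\subset\mathcal S\times\mathcal S$ the directed edges, and $\lambda:\mathcal E\to(0,\infty)$; write $\lambda_e=\lambda(e)$. Standing assumptions: the graph is strongly connected, has no edges of the form $(y,y)$, and is invariant under integer translations (for $n\in\mathbb Z^d$: $x\in\mathcal S\Rightarrow x+n\in\mathcal S$; $(x,y)\in\mathcal E\Rightarrow(x+n,y+n)\in\mathcal E$ and $\lambda(x+n,y+n)=\lambda(x,y)$). For $e=(x,y)\in\mathcal E$: $\partial_-e=x$, $\partial_+e=y$, $\nu_e=y-x$. For $y\in\mathcal S$: $\mathcal E_y=\{e\in\mathcal E:\partial_-e=y\}$. $\bar{\mathcal S}$ is the quotient of $\mathcal S$ by $\mathbb Z^d$-translations, identified with $\mathcal S\cap[0,1)^d$. $\bar{\mathcal E}$ is the quotient of $\mathcal E$ by simultaneous translation of both endpoints by the same element of $\mathbb Z^d$, identified with $\bigcup_{y\in\bar{\mathcal S}}\mathcal E_y$. Both $\bar{\mathcal S}$ and $\bar{\mathcal E}$ are assumed finite. Nodes appearing as arguments of functions on $\bar{\mathcal S}$ are taken modulo $\mathbb Z^d$.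 Generator. $(Lf)(y)=\sum_{e\in\mathcal E_y}(f(y+\nu_e)-f(y))\lambda_e$ for $f:\bar{\mathcal S}\to\mathbb R$, $y\in\bar{\mathcal S}$. $L^T$ is its transpose. $\pi$ is the unique function on $\bar{\mathcal S}$ with $L^T\pi=0$, $\sum_{y\in\bar{\mathcal S}}\pi(y)=1$. Drift field: $\rho(y)=\sum_{e\in\mathcal E_y}\nu_e\lambda_e$. Long run drift rate: $\bar U=\sum_{y\in\bar{\mathcal S}}\rho(y)\pi(y)=\sum_{e\in\bar{\mathcal E}}\nu_e\lambda_e\pi(\partial_-e)$. Random walk. $Z$ is the cadlag continuous-time Markov jump process on $\mathcal S$ that jumps from $x$ to $y$ along $(x,y)\in\mathcal E$ at rate $\lambda(x,y)$, with $Z(0)=0\in\mathcal S$. *)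

theory Defs
  imports "HOL-Probability.Probability"
begin

text \<open>Nodes are vectors in \<open>real ^ 'd\<close>, edges are pairs (source, target), and \<open>lam\<close> is only
  relevant on \<open>E\<close>. The finite quotients modulo integer translations are
  represented by the nodes in the half-open unit cube and by the edges issuing from them.\<close>

type_synonym 'd edge = "(real ^ 'd) \<times> (real ^ 'd)"

definition int_lattice :: "(real ^ 'd) set" where
  "int_lattice = {n. \<forall>i. n $ i \<in> \<int>}"

definition nu :: "'d edge \<Rightarrow> real ^ 'd" where
  "nu e = snd e - fst e"

definition out_edges :: "'d edge set \<Rightarrow> real ^ 'd \<Rightarrow> 'd edge set" where
  "out_edges E y = {e \<in> E. fst e = y}"

definition Sbar :: "(real ^ 'd) set \<Rightarrow> (real ^ 'd) set" where
  "Sbar S = S \<inter> {x. \<forall>i. 0 \<le> x $ i \<and> x $ i < 1}"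

definition Ebar :: "(real ^ 'd) set \<Rightarrow> 'd edge set \<Rightarrow> 'd edge set" where
  "Ebar S E = (\<Union>y\<in>Sbar S. out_edges E y)"

text \<open>The representative of a point modulo integer translations in the half-open unit cube.\<close>

definition rep :: "real ^ 'd \<Rightarrow> real ^ 'd" where
  "rep x = (\<chi> i. frac (x $ i))"

locale periodic_graph =
  fixes S :: "(real ^ 'd) set" and E :: "'d edge set" and lam :: "'d edge \<Rightarrow> real"
  assumes countable_S: "countable S"
    and E_subset: "E \<subseteq> S \<times> S"
    and lam_pos: "\<And>e. e \<in> E \<Longrightarrow> 0 < lam e"
    and strongly_connected: "\<And>x y. x \<in> S \<Longrightarrow> y \<in> S \<Longrightarrow> (x, y) \<in> E\<^sup>*"
    and no_loops: "\<And>y. (y, y) \<notin> E"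
    and S_translate: "\<And>x n. n \<in> int_lattice \<Longrightarrow> x \<in> S \<Longrightarrow> x + n \<in> S"
    and E_translate: "\<And>x y n. n \<in> int_lattice \<Longrightarrow> (x, y) \<in> E \<Longrightarrow> (x + n, y + n) \<in> E"
    and lam_translate:
      "\<And>x y n. n \<in> int_lattice \<Longrightarrow> (x, y) \<in> E \<Longrightarrow> lam (x + n, y + n) = lam (x, y)"
    and finite_Sbar: "finite (Sbar S)"
    and finite_Ebar: "finite (Ebar S E)"

definition gen :: "'d edge set \<Rightarrow> ('d edge \<Rightarrow> real) \<Rightarrow> (real ^ 'd \<Rightarrow> real) \<Rightarrow> real ^ 'd \<Rightarrow> real" where
  "gen E lam f y = (\<Sum>e\<in>out_edges E y. (f (rep (y + nu e)) - f y) * lam e)"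

text \<open>The matrix of the generator on functions on \<open>Sbar S\<close> has the entry
  \<open>gen E lam (indicator {z}) y\<close> in row \<open>y\<close> and column \<open>z\<close>.\<close>

definition gen_transpose ::
  "(real ^ 'd) set \<Rightarrow> 'd edge set \<Rightarrow> ('d edge \<Rightarrow> real) \<Rightarrow> (real ^ 'd \<Rightarrow> real) \<Rightarrow> real ^ 'd \<Rightarrow> real" where
  "gen_transpose S E lam g z = (\<Sum>y\<in>Sbar S. gen E lam (indicator {z}) y * g y)"

definition stat_dist :: "(real ^ 'd) set \<Rightarrow> 'd edge set \<Rightarrow> ('d edge \<Rightarrow> real) \<Rightarrow> real ^ 'd \<Rightarrow> real" where
  "stat_dist S E lam = (THE p. p \<in> extensional (Sbar S) \<and>
     (\<forall>z\<in>Sbar S. gen_transpose S E lam p z = 0) \<and> (\<Sum>y\<in>Sbar S. p y) = 1)"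

definition drift :: "'d edge set \<Rightarrow> ('d edge \<Rightarrow> real) \<Rightarrow> real ^ 'd \<Rightarrow> real ^ 'd" where
  "drift E lam y = (\<Sum>e\<in>out_edges E y. lam e *\<^sub>R nu e)"

definition Ubar :: "(real ^ 'd) set \<Rightarrow> 'd edge set \<Rightarrow> ('d edge \<Rightarrow> real) \<Rightarrow> real ^ 'd" where
  "Ubar S E lam = (\<Sum>y\<in>Sbar S. stat_dist S E lam y *\<^sub>R drift E lam y)"

definition edge_rate :: "'d edge set \<Rightarrow> ('d edge \<Rightarrow> real) \<Rightarrow> real ^ 'd \<Rightarrow> real ^ 'd \<Rightarrow> real" where
  "edge_rate E lam x y = (if (x, y) \<in> E then lam (x, y) else 0)"

definition exit_rate :: "'d edge set \<Rightarrow> ('d edge \<Rightarrow> real) \<Rightarrow> real ^ 'd \<Rightarrow> real" where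
  "exit_rate E lam x = (\<Sum>e\<in>out_edges E x. lam e)"

definition cadlag :: "(real \<Rightarrow> 'b :: topological_space) \<Rightarrow> bool" where
  "cadlag f \<longleftrightarrow> (\<forall>t\<ge>0. (f \<longlongrightarrow> f t) (at_right t)) \<and> (\<forall>t>0. \<exists>l. (f \<longlongrightarrow> l) (at_left t))"

text \<open>The continuous-time Markov jump process with the given jump rates, started at \<open>x0\<close>,
  in terms of its jump chain \<open>Y\<close> and holding times \<open>tau\<close>: \<open>Y\<close> is
  a Markov chain with transition probabilities \<open>edge_rate x y / exit_rate x\<close>, and, conditionally
  on \<open>Y\<close>, the \<open>tau n\<close> are independent exponential variables with parameters
  \<open>exit_rate (Y n)\<close>. The case \<open>n = 0\<close>, \<open>s 0 = 0\<close> of the joint law gives \<open>Y 0 = x0\<close> and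
  \<open>tau 0 > 0\<close> almost surely. No state is absorbing in the situation
  considered, so every exit rate is positive.\<close>

definition markov_jump_process ::
  "'w measure \<Rightarrow> (real ^ 'd) set \<Rightarrow> 'd edge set \<Rightarrow> ('d edge \<Rightarrow> real) \<Rightarrow> real ^ 'd \<Rightarrow>
   (real \<Rightarrow> 'w \<Rightarrow> real ^ 'd) \<Rightarrow> bool" where
  "markov_jump_process M S E lam x0 Z \<longleftrightarrow>
     (\<forall>t\<ge>0. Z t \<in> measurable M (count_space S)) \<and>
     (AE \<omega> in M. cadlag (\<lambda>t. Z t \<omega>) \<and> Z 0 \<omega> = x0) \<and>
     (\<exists>(Y :: nat \<Rightarrow> 'w \<Rightarrow> real ^ 'd) (tau :: nat \<Rightarrow> 'w \<Rightarrow> real).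
        (\<forall>n. Y n \<in> measurable M (count_space S)) \<and>
        (\<forall>n. tau n \<in> borel_measurable M) \<and>
        (\<forall>n (x :: nat \<Rightarrow> real ^ 'd) (s :: nat \<Rightarrow> real).
           x 0 = x0 \<and> (\<forall>i\<le>n. x i \<in> S \<and> 0 \<le> s i) \<longrightarrow>
           measure M {\<omega> \<in> space M. \<forall>i\<le>n. Y i \<omega> = x i \<and> s i < tau i \<omega>} =
             (\<Prod>i<n. edge_rate E lam (x i) (x (Suc i)) / exit_rate E lam (x i)) *
             (\<Prod>i\<le>n. exp (- exit_rate E lam (x i) * s i))) \<and>
        (AE \<omega> in M. \<forall>n t. (\<Sum>i<n. tau i \<omega>) \<le> t \<and> t < (\<Sum>i<Suc n. tau i \<omega>) \<longrightarrow> Z t \<omega> = Y n \<omega>))"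

definition rescaled :: "(real \<Rightarrow> 'w \<Rightarrow> real ^ 'd) \<Rightarrow> real \<Rightarrow> real \<Rightarrow> 'w \<Rightarrow> real ^ 'd" where
  "rescaled Z \<epsilon> t \<omega> = \<epsilon>\<^sup>2 *\<^sub>R Z (t / \<epsilon>\<^sup>2) \<omega>"

end

theory Submission
  imports Defs "HOL-Library.Discrete_Functions"
begin

text \<open>Everything follows from a strong law of large numbers for the unscaled walk: almost surely
  \<open>Z t / t\<close> converges to \<open>U = Ubar S E lam\<close>. Writing \<open>s = t / \<epsilon>\<^sup>2\<close>, the error
  \<open>\<epsilon>\<^sup>2 Z s - t U\<close> equals \<open>t (Z s / s - U)\<close>, and for \<open>t\<close> between \<open>t0\<close> and \<open>T\<close> the time \<open>s\<close> is at
  least \<open>t0 / \<epsilon>\<^sup>2\<close>; hence the convergence is uniform on the interval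
  (\<open>uniform_rescaled_limit\<close>). The bound \<open>t0 > 0\<close> makes all the times \<open>s\<close> large at once.

  The strong law is proved along the jump times, with a corrector. Fix a coordinate \<open>i\<close> and let
  \<open>L = gen E lam\<close> be the generator on functions on the finite quotient. The Poisson equation
  \<open>L f = U\<^sub>i - drift\<^sub>i\<close> has a solution \<open>f\<close> because its right-hand side has mean zero under the
  stationary distribution (\<open>corrector\<close>). Consequently, with \<open>q\<close> the exit rate, the increments
  \<open>(y - x)\<^sub>i + f (rep y) - f (rep x) - U\<^sub>i / q x\<close> have mean zero under a jump from \<open>x\<close>
  (\<open>increment_centred\<close>), and so do the differences \<open>1 / q x - tau\<close> between the mean holding
  time at \<open>x\<close> and the holding time itself. Summed along the jump chain, the first kind plus \<open>U\<^sub>i\<close>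
  times the second kind telescopes to the position minus \<open>U\<^sub>i\<close> times the elapsed time, up to the
  bounded term coming from \<open>f\<close>.

  Both kinds of variables are orthogonal with bounded second moments, so their averages tend to
  zero almost surely (\<open>orthogonal_strong_law\<close>, \<open>chain_strong_law\<close>,
  \<open>holding_times_strong_law\<close>). Since the mean holding times are bounded below, the time of the
  \<open>n\<close>-th jump grows at least linearly in \<open>n\<close>; in particular there is no explosion, and an error of
  order \<open>o(n)\<close> after \<open>n\<close> jumps is an error of order \<open>o(t)\<close> at time \<open>t\<close>. This passage from jump times
  to all times is a statement about single paths (\<open>jump_path_asymptotics\<close>).\<close>

section \<open>Averages of orthogonal random variables\<close>

text \<open>By monotone convergence the sum of the \<open>f m\<close> has finite expectation, hence is almost surely finite,
  and the terms of a convergent series tend to zero.\<close>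

lemma (in prob_space) AE_LIMSEQ_0_of_summable_expectations:
  fixes f :: "nat \<Rightarrow> 'a \<Rightarrow> real"
  assumes int: "\<And>m. integrable M (f m)" and nonneg: "\<And>m \<omega>. 0 \<le> f m \<omega>"
    and summ: "summable (\<lambda>m. expectation (f m))"
  shows "AE \<omega> in M. (\<lambda>m. f m \<omega>) \<longlonglongrightarrow> 0"
proof -
  have [measurable]: "f m \<in> borel_measurable M" for m using int by auto
  have "(\<integral>\<^sup>+ \<omega>. (\<Sum>m. ennreal (f m \<omega>)) \<partial>M) = (\<Sum>m. \<integral>\<^sup>+ \<omega>. ennreal (f m \<omega>) \<partial>M)"
    by (intro nn_integral_suminf) auto
  also have "\<dots> = (\<Sum>m. ennreal (expectation (f m)))"
    using int nonneg by (intro suminf_cong nn_integral_eq_integral) auto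
  also have "\<dots> = ennreal (\<Sum>m. expectation (f m))"
    using summ nonneg by (intro suminf_ennreal2) auto
  finally have "(\<integral>\<^sup>+ \<omega>. (\<Sum>m. ennreal (f m \<omega>)) \<partial>M) \<noteq> \<infinity>" by simp
  then have "AE \<omega> in M. (\<Sum>m. ennreal (f m \<omega>)) \<noteq> \<infinity>"
    by (intro nn_integral_PInf_AE) auto
  then show ?thesis
  proof (rule AE_mp, intro AE_I2 impI)
    fix \<omega> assume "(\<Sum>m. ennreal (f m \<omega>)) \<noteq> \<infinity>"
    then have "summable (\<lambda>m. f m \<omega>)" using nonneg by (intro summable_suminf_not_top) auto
    then show "(\<lambda>m. f m \<omega>) \<longlonglongrightarrow> 0" by (rule summable_LIMSEQ_zero)
  qed
qed

lemma integrable_mult_of_squares: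
  fixes f g :: "'a \<Rightarrow> real"
  assumes [measurable]: "f \<in> borel_measurable M" "g \<in> borel_measurable M"
    and "integrable M (\<lambda>x. (f x)\<^sup>2)" "integrable M (\<lambda>x. (g x)\<^sup>2)"
  shows "integrable M (\<lambda>x. f x * g x)"
proof (rule Bochner_Integration.integrable_bound)
  show "integrable M (\<lambda>x. (f x)\<^sup>2 + (g x)\<^sup>2)" using assms by auto
  have "\<bar>a * b\<bar> \<le> a\<^sup>2 + b\<^sup>2" for a b :: real
  proof -
    have "0 \<le> \<bar>a\<bar> * \<bar>b\<bar>" by simp
    with sum_squares_bound[of "\<bar>a\<bar>" "\<bar>b\<bar>"] show ?thesis
      unfolding abs_mult power2_abs mult.assoc by linarith
  qed
  then show "AE x in M. norm (f x * g x) \<le> norm ((f x)\<^sup>2 + (g x)\<^sup>2)" by simp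
qed auto

text \<open>By orthogonality the second moment of a sum of \<open>n\<close> terms is at most \<open>C n\<close>. Along the squares
  \<open>n = m\<^sup>2\<close> the averages therefore have second moments at most \<open>C / m\<^sup>2\<close>, which is summable
  (the variables \<open>A m\<close>). The terms between \<open>m\<^sup>2\<close> and \<open>(m + 1)\<^sup>2\<close> are so few that their absolute
  values can simply be added: by Cauchy-Schwarz this block, divided by \<open>m\<^sup>2\<close>, has second moment of
  order \<open>1 / m\<^sup>2\<close> as well (the variables \<open>B m\<close>).\<close>

theorem (in prob_space) orthogonal_strong_law:
  fixes X :: "nat \<Rightarrow> 'a \<Rightarrow> real"
  assumes meas[measurable]: "\<And>k. X k \<in> borel_measurable M"
    and int: "\<And>k. integrable M (\<lambda>\<omega>. (X k \<omega>)\<^sup>2)"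
    and bound: "\<And>k. expectation (\<lambda>\<omega>. (X k \<omega>)\<^sup>2) \<le> C"
    and orth: "\<And>j k. j < k \<Longrightarrow> expectation (\<lambda>\<omega>. X j \<omega> * X k \<omega>) = 0"
  shows "AE \<omega> in M. (\<lambda>n. (\<Sum>k<n. X k \<omega>) / real n) \<longlonglongrightarrow> 0"
proof -
  have intp: "integrable M (\<lambda>\<omega>. X j \<omega> * X k \<omega>)" for j k
    by (intro integrable_mult_of_squares int meas)
  have orth': "expectation (\<lambda>\<omega>. X j \<omega> * X k \<omega>) = (if j = k then expectation (\<lambda>\<omega>. (X k \<omega>)\<^sup>2) else 0)" for j k
    using orth[of j k] orth[of k j] by (cases j k rule: linorder_cases) (auto simp: power2_eq_square mult.commute)
  define A where "A m \<omega> = ((\<Sum>k<m\<^sup>2. X k \<omega>) / (real m)\<^sup>2)\<^sup>2" for m \<omega>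
  define B where "B m \<omega> = ((\<Sum>k\<in>{m\<^sup>2..<(Suc m)\<^sup>2}. \<bar>X k \<omega>\<bar>) / (real m)\<^sup>2)\<^sup>2" for m \<omega>
  have "AE \<omega> in M. (\<lambda>m. A m \<omega>) \<longlonglongrightarrow> 0"
  proof (rule AE_LIMSEQ_0_of_summable_expectations)
    have A_eq: "A m = (\<lambda>\<omega>. (\<Sum>j<m\<^sup>2. \<Sum>k<m\<^sup>2. X j \<omega> * X k \<omega>) / real m ^ 4)" for m
      by (auto simp: A_def fun_eq_iff power_divide sum_product power2_eq_square[of "sum _ _"] simp flip: power_mult)
    show int_A: "integrable M (A m)" for m
      unfolding A_eq by (intro integrable_divide Bochner_Integration.integrable_sum intp)
    show "0 \<le> A m \<omega>" for m \<omega> by (simp add: A_def)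
    have "expectation (A m) \<le> C / (real m)\<^sup>2" for m
    proof -
      have "expectation (A m) = (\<Sum>j<m\<^sup>2. \<Sum>k<m\<^sup>2. expectation (\<lambda>\<omega>. X j \<omega> * X k \<omega>)) / real m ^ 4"
        unfolding A_eq by (subst integral_divide_zero) (simp add: Bochner_Integration.integral_sum intp)
      also have "\<dots> = (\<Sum>j<m\<^sup>2. expectation (\<lambda>\<omega>. (X j \<omega>)\<^sup>2)) / real m ^ 4"
        by (simp add: orth')
      also have "\<dots> \<le> (\<Sum>j<m\<^sup>2. C) / real m ^ 4"
        by (intro divide_right_mono sum_mono bound) auto
      also have "\<dots> = C / (real m)\<^sup>2"
        by (simp add: power2_eq_square power4_eq_xxxx)
      finally show ?thesis .
    qed
    moreover have "summable (\<lambda>m. C / (real m)\<^sup>2)"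
      using summable_mult[OF inverse_power_summable[of 2, where 'a=real], of C] by (simp add: divide_inverse)
    moreover have "0 \<le> expectation (A m)" for m
      by (intro Bochner_Integration.integral_nonneg) (simp add: A_def)
    ultimately show "summable (\<lambda>m. expectation (A m))"
      by (metis (no_types, lifting) summable_comparison_test' real_norm_def abs_of_nonneg)
  qed
  moreover have "AE \<omega> in M. (\<lambda>m. B m \<omega>) \<longlonglongrightarrow> 0"
  proof (rule AE_LIMSEQ_0_of_summable_expectations)
    let ?I = "\<lambda>m::nat. {m\<^sup>2..<(Suc m)\<^sup>2}"
    have card_I: "real (card (?I m)) = 2 * real m + 1" for m
      by (simp add: power2_eq_square algebra_simps)
    have B_le: "B m \<omega> \<le> (2 * real m + 1) * (\<Sum>k\<in>?I m. (X k \<omega>)\<^sup>2) / real m ^ 4" for m \<omega>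
    proof -
      have "(\<Sum>k\<in>?I m. \<bar>X k \<omega>\<bar>)\<^sup>2 \<le> (\<Sum>k\<in>?I m. (1::real)\<^sup>2) * (\<Sum>k\<in>?I m. \<bar>X k \<omega>\<bar>\<^sup>2)"
        using Cauchy_Schwarz_ineq_sum[of "\<lambda>_. 1::real" "\<lambda>k. \<bar>X k \<omega>\<bar>" "?I m"] by simp
      also have "\<dots> = (2 * real m + 1) * (\<Sum>k\<in>?I m. (X k \<omega>)\<^sup>2)"
        using card_I[of m] by simp
      finally show ?thesis
        by (simp add: B_def power_divide divide_right_mono flip: power_mult)
    qed
    have int_bd: "integrable M (\<lambda>\<omega>. (2 * real m + 1) * (\<Sum>k\<in>?I m. (X k \<omega>)\<^sup>2) / real m ^ 4)" for m
      by (intro integrable_divide Bochner_Integration.integrable_mult_right Bochner_Integration.integrable_sum int)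
    have [measurable]: "B m \<in> borel_measurable M" for m
      unfolding B_def by measurable
    show nonneg: "0 \<le> B m \<omega>" for m \<omega> by (simp add: B_def)
    show int_B: "integrable M (B m)" for m
    proof (rule Bochner_Integration.integrable_bound[OF int_bd[of m]])
      have "norm (B m \<omega>) \<le> norm ((2 * real m + 1) * (\<Sum>k\<in>?I m. (X k \<omega>)\<^sup>2) / real m ^ 4)" for \<omega>
        unfolding real_norm_def abs_of_nonneg[OF nonneg] by (rule order.trans[OF B_le abs_ge_self])
      then show "AE \<omega> in M. norm (B m \<omega>) \<le> norm ((2 * real m + 1) * (\<Sum>k\<in>?I m. (X k \<omega>)\<^sup>2) / real m ^ 4)"
        by blast
    qed measurable
    have "expectation (B m) \<le> C * (2 * real m + 1)\<^sup>2 / real m ^ 4" for m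
    proof -
      have "expectation (B m) \<le> expectation (\<lambda>\<omega>. (2 * real m + 1) * (\<Sum>k\<in>?I m. (X k \<omega>)\<^sup>2) / real m ^ 4)"
        by (intro integral_mono int_B int_bd B_le)
      also have "\<dots> = (2 * real m + 1) * (\<Sum>k\<in>?I m. expectation (\<lambda>\<omega>. (X k \<omega>)\<^sup>2)) / real m ^ 4"
        by (simp add: Bochner_Integration.integral_sum int)
      also have "\<dots> \<le> (2 * real m + 1) * (\<Sum>k\<in>?I m. C) / real m ^ 4"
        by (intro divide_right_mono mult_left_mono sum_mono bound) auto
      also have "\<dots> = C * (2 * real m + 1)\<^sup>2 / real m ^ 4"
        using card_I[of m] by (simp add: power2_eq_square)
      finally show ?thesis .
    qed
    moreover have "summable (\<lambda>m. C * (2 * real m + 1)\<^sup>2 / real m ^ 4)"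
    proof (rule summable_comparison_test'[of "\<lambda>m. \<bar>C\<bar> * 9 * inverse ((real m)\<^sup>2)" 1])
      show "summable (\<lambda>m. \<bar>C\<bar> * 9 * inverse ((real m)\<^sup>2))"
        by (intro summable_mult inverse_power_summable) auto
      fix m :: nat assume "1 \<le> m"
      then have "(2 * real m + 1)\<^sup>2 \<le> (3 * real m)\<^sup>2" by (intro power_mono) auto
      then have "\<bar>C\<bar> * (2 * real m + 1)\<^sup>2 / real m ^ 4 \<le> \<bar>C\<bar> * (3 * real m)\<^sup>2 / real m ^ 4"
        by (intro divide_right_mono mult_left_mono) auto
      also have "\<dots> = \<bar>C\<bar> * 9 * inverse ((real m)\<^sup>2)"
        using \<open>1 \<le> m\<close> by (simp add: field_simps power2_eq_square power4_eq_xxxx)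
      finally show "norm (C * (2 * real m + 1)\<^sup>2 / real m ^ 4) \<le> \<bar>C\<bar> * 9 * inverse ((real m)\<^sup>2)"
        by (simp add: abs_mult)
    qed
    moreover have "0 \<le> expectation (B m)" for m
      by (intro Bochner_Integration.integral_nonneg nonneg)
    ultimately show "summable (\<lambda>m. expectation (B m))"
      by (metis (no_types, lifting) summable_comparison_test' real_norm_def abs_of_nonneg)
  qed
  ultimately show ?thesis
  proof eventually_elim
    case (elim \<omega>)
    \<comment> \<open>\<open>D m\<close> dominates the absolute averages over \<open>n\<close> terms for all \<open>n\<close> in \<open>{m\<^sup>2..<(Suc m)\<^sup>2}\<close>.\<close>
    define D where "D m = sqrt (A m \<omega>) + sqrt (B m \<omega>)" for m
    have "D \<longlonglongrightarrow> 0"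
      using tendsto_add[OF tendsto_real_sqrt[OF elim(1)] tendsto_real_sqrt[OF elim(2)]]
      by (simp add: D_def[abs_def])
    moreover have "filterlim floor_sqrt at_top sequentially"
      unfolding filterlim_at_top
      by (metis (mono_tags, lifting) eventually_sequentiallyI le_floor_sqrtI power2_nat_le_eq_le)
    ultimately have lim: "(\<lambda>n. D (floor_sqrt n)) \<longlonglongrightarrow> 0" by (rule filterlim_compose)
    show ?case
    proof (rule Lim_null_comparison[OF _ lim])
      show "\<forall>\<^sub>F n in sequentially. norm ((\<Sum>k<n. X k \<omega>) / real n) \<le> D (floor_sqrt n)"
        using eventually_gt_at_top[of 0]
      proof eventually_elim
        case n: (elim n)
        define m where "m = floor_sqrt n"
        have m: "m\<^sup>2 \<le> n" "n < (Suc m)\<^sup>2" "0 < m"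
          using n Suc_floor_sqrt_power2_gt[of n] by (auto simp: m_def)
        have "\<bar>\<Sum>k<n. X k \<omega>\<bar> = \<bar>(\<Sum>k<m\<^sup>2. X k \<omega>) + (\<Sum>k\<in>{m\<^sup>2..<n}. X k \<omega>)\<bar>"
          using m by (simp add: sum.atLeastLessThan_concat lessThan_atLeast0)
        also have "\<dots> \<le> \<bar>\<Sum>k<m\<^sup>2. X k \<omega>\<bar> + (\<Sum>k\<in>{m\<^sup>2..<n}. \<bar>X k \<omega>\<bar>)"
          by (intro order.trans[OF abs_triangle_ineq] add_mono sum_abs) auto
        also have "\<dots> \<le> \<bar>\<Sum>k<m\<^sup>2. X k \<omega>\<bar> + (\<Sum>k\<in>{m\<^sup>2..<(Suc m)\<^sup>2}. \<bar>X k \<omega>\<bar>)"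
          using m by (intro add_left_mono sum_mono2) auto
        finally have "\<bar>\<Sum>k<n. X k \<omega>\<bar> / real n \<le> (\<bar>\<Sum>k<m\<^sup>2. X k \<omega>\<bar> + (\<Sum>k\<in>{m\<^sup>2..<(Suc m)\<^sup>2}. \<bar>X k \<omega>\<bar>)) / (real m)\<^sup>2"
          using m by (intro frac_le) (auto intro!: add_nonneg_nonneg sum_nonneg simp flip: of_nat_power)
        also have "\<dots> = D m"
          by (simp add: D_def A_def B_def add_divide_distrib abs_of_nonneg sum_nonneg)
        finally show ?case by (simp add: m_def)
      qed
    qed
  qed
qed

section \<open>Exponential moments from tail probabilities\<close>

text \<open>The weight \<open>g\<close> makes it possible to apply the formula twice, which expresses an integral of a product
  of two random variables through their joint tail probabilities. Negative values of \<open>X\<close> contribute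
  nothing to either side.\<close>

lemma (in sigma_finite_measure) nn_integral_layer_cake_weighted:
  fixes X :: "'a \<Rightarrow> real"
  assumes [measurable]: "g \<in> borel_measurable M" "X \<in> borel_measurable M"
  shows "(\<integral>\<^sup>+ \<omega>. g \<omega> * ennreal (X \<omega>) \<partial>M) =
    (\<integral>\<^sup>+ s. indicator {0..} s * (\<integral>\<^sup>+ \<omega>. g \<omega> * indicator {s<..} (X \<omega>) \<partial>M) \<partial>lborel)"
proof -
  interpret P: pair_sigma_finite M lborel ..
  have "(\<integral>\<^sup>+ \<omega>. g \<omega> * ennreal (X \<omega>) \<partial>M) =
      (\<integral>\<^sup>+ \<omega>. (\<integral>\<^sup>+ s. g \<omega> * (indicator {0..} s * indicator {s<..} (X \<omega>)) \<partial>lborel) \<partial>M)"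
  proof (rule nn_integral_cong)
    fix \<omega>
    have "indicator {0..} s * indicator {s<..} (X \<omega>) = (indicator {0..<X \<omega>} s :: ennreal)" for s
      by (auto simp: indicator_def)
    then have "(\<integral>\<^sup>+ s. g \<omega> * (indicator {0..} s * indicator {s<..} (X \<omega>)) \<partial>lborel) = g \<omega> * emeasure lborel {0..<X \<omega>}"
      by (simp add: nn_integral_cmult)
    also have "emeasure lborel {0..<X \<omega>} = ennreal (X \<omega>)"
      by (cases "0 \<le> X \<omega>") (simp_all add: ennreal_neg)
    finally show "g \<omega> * ennreal (X \<omega>) = (\<integral>\<^sup>+ s. g \<omega> * (indicator {0..} s * indicator {s<..} (X \<omega>)) \<partial>lborel)" ..
  qed
  also have "\<dots> = (\<integral>\<^sup>+ s. (\<integral>\<^sup>+ \<omega>. g \<omega> * (indicator {0..} s * indicator {s<..} (X \<omega>)) \<partial>M) \<partial>lborel)"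
    by (intro P.Fubini'[symmetric]) (simp add: indicator_def)
  also have "\<dots> = (\<integral>\<^sup>+ s. indicator {0..} s * (\<integral>\<^sup>+ \<omega>. g \<omega> * indicator {s<..} (X \<omega>) \<partial>M) \<partial>lborel)"
    by (intro nn_integral_cong) (simp add: nn_integral_cmult[symmetric] mult_ac)
  finally show ?thesis .
qed

text \<open>This is the normalisation of the exponential density.\<close>

lemma nn_integral_exp_neg:
  assumes "0 < l"
  shows "(\<integral>\<^sup>+ s. indicator {0..} s * ennreal (c * exp (- (l * s))) \<partial>lborel) = ennreal (c / l)"
proof (cases "0 \<le> c")
  case True
  have "(\<integral>\<^sup>+ s. ennreal (c / l) * ennreal (exponential_density l s) \<partial>lborel) = ennreal (c / l) * 1"
    using prob_space.emeasure_space_1[OF prob_space_exponential_density[OF assms]]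
    by (simp add: nn_integral_cmult emeasure_density)
  moreover have "(\<integral>\<^sup>+ s. ennreal (c / l) * ennreal (exponential_density l s) \<partial>lborel) =
      (\<integral>\<^sup>+ s. indicator {0..} s * ennreal (c * exp (- (l * s))) \<partial>lborel)"
    using assms True
    by (intro nn_integral_cong) (auto simp: exponential_density_def indicator_def mult_ac simp flip: ennreal_mult')
  ultimately show ?thesis by simp
next
  case False
  then have "ennreal (c * exp (- (l * s))) = 0" for s by (intro ennreal_neg) (simp add: mult_le_0_iff)
  moreover have "ennreal (c / l) = 0" using False assms by (intro ennreal_neg) (simp add: divide_le_0_iff)
  ultimately show ?thesis by simp
qed

lemma nn_integral_exp_neg2:
  assumes "0 < a" "0 < b" 
  shows "(\<integral>\<^sup>+ s. indicator {0..} s * (\<integral>\<^sup>+ t. indicator {0..} t *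
      ennreal (c * exp (- (a * s)) * exp (- (b * t))) \<partial>lborel) \<partial>lborel) = ennreal (c / (a * b))"
proof -
  have "(\<integral>\<^sup>+ s. indicator {0..} s * (\<integral>\<^sup>+ t. indicator {0..} t *
      ennreal (c * exp (- (a * s)) * exp (- (b * t))) \<partial>lborel) \<partial>lborel) =
      (\<integral>\<^sup>+ s. indicator {0..} s * ennreal ((c / b) * exp (- (a * s))) \<partial>lborel)"
    using nn_integral_exp_neg[OF assms(2)] by simp
  also have "\<dots> = ennreal (c / b / a)" by (rule nn_integral_exp_neg[OF assms(1)])
  finally show ?thesis by (simp add: mult.commute)
qed

section \<open>Markov chains with exponential holding times\<close>

text \<open>The jump chain and the holding times of a Markov jump process on an arbitrary countable state space.
  From \<open>x\<close> the chain moves to one of the finitely many states in \<open>N x\<close>, with probabilities \<open>p x\<close>, after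
  a holding time of rate \<open>q x\<close>. The joint law is prescribed only through the events in \<open>law\<close>, so
  every moment below has to be read off from these probabilities.\<close>

locale jump_chain = prob_space M for M :: "'w measure" +
  fixes S :: "'s set" and N :: "'s \<Rightarrow> 's set" and p :: "'s \<Rightarrow> 's \<Rightarrow> real" and q :: "'s \<Rightarrow> real"
    and x0 :: 's and Y :: "nat \<Rightarrow> 'w \<Rightarrow> 's" and tau :: "nat \<Rightarrow> 'w \<Rightarrow> real" and qmin :: real
  assumes countable_S: "countable S" and x0: "x0 \<in> S"
    and N_subset: "\<And>x. x \<in> S \<Longrightarrow> N x \<subseteq> S" and finite_N: "\<And>x. x \<in> S \<Longrightarrow> finite (N x)"
    and p_sum: "\<And>x. x \<in> S \<Longrightarrow> (\<Sum>y\<in>N x. p x y) = 1"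
    and qmin: "0 < qmin" and q_ge: "\<And>x. x \<in> S \<Longrightarrow> qmin \<le> q x"
    and Y_meas[measurable]: "\<And>n. Y n \<in> measurable M (count_space S)"
    and tau_meas[measurable]: "\<And>n. tau n \<in> borel_measurable M"
    and law: "\<And>n x s. x 0 = x0 \<Longrightarrow> (\<And>i. i \<le> n \<Longrightarrow> x i \<in> S \<and> 0 \<le> s i) \<Longrightarrow>
      prob {\<omega> \<in> space M. \<forall>i\<le>n. Y i \<omega> = x i \<and> s i < tau i \<omega>} =
        (\<Prod>i<n. p (x i) (x (Suc i))) * (\<Prod>i\<le>n. exp (- q (x i) * s i))"
begin

lemma q_pos: "x \<in> S \<Longrightarrow> 0 < q x"
  using qmin q_ge by (meson less_le_trans)

lemma Y_in_S: "\<omega> \<in> space M \<Longrightarrow> Y n \<omega> \<in> S"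
  using measurable_space[OF Y_meas] by simp

lemma Y_function_measurable: "(\<lambda>\<omega>. f (Y n \<omega>)) \<in> borel_measurable M" for f :: "'s \<Rightarrow> real"
  by (rule measurable_compose_countable'[OF _ Y_meas countable_S]) auto

lemma Y_function2_measurable: "(\<lambda>\<omega>. f (Y m \<omega>) (Y n \<omega>)) \<in> borel_measurable M" for f :: "'s \<Rightarrow> 's \<Rightarrow> real"
  by (rule measurable_compose_countable'[OF _ Y_meas countable_S]) (rule Y_function_measurable)

text \<open>The chain follows \<open>x\<close> for \<open>n\<close> jumps. Positivity of the holding times is part of the event because
  the prescribed events always contain a lower bound on the holding times; \<open>s = 0\<close> gives exactly
  this one.\<close>

definition cyl :: "(nat \<Rightarrow> 's) \<Rightarrow> nat \<Rightarrow> 'w set" where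
  "cyl x n = {\<omega> \<in> space M. \<forall>i\<le>n. Y i \<omega> = x i \<and> 0 < tau i \<omega>}"

definition weight :: "(nat \<Rightarrow> 's) \<Rightarrow> nat \<Rightarrow> real" where
  "weight x n = (\<Prod>i<n. p (x i) (x (Suc i)))"

definition trajectory :: "(nat \<Rightarrow> 's) \<Rightarrow> nat \<Rightarrow> bool" where
  "trajectory x n \<longleftrightarrow> x 0 = x0 \<and> (\<forall>i\<le>n. x i \<in> S)"

lemma Y_eq_measurable[measurable]: "Measurable.pred M (\<lambda>\<omega>. Y i \<omega> = z)"
proof (cases "z \<in> S")
  case True
  then have "Y i -` {z} \<inter> space M \<in> sets M" by (intro measurable_sets[OF Y_meas]) auto
  also have "Y i -` {z} \<inter> space M = {\<omega> \<in> space M. Y i \<omega> = z}" by auto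
  finally show ?thesis by (simp add: pred_def)
next
  case False
  then have "Measurable.pred M (\<lambda>\<omega>. Y i \<omega> = z) \<longleftrightarrow> Measurable.pred M (\<lambda>\<omega>. False)"
    by (intro measurable_cong) (use Y_in_S in blast)
  then show ?thesis by simp
qed

lemma cyl_sets[measurable]: "cyl x n \<in> sets M"
  unfolding cyl_def by measurable

lemma prob_cyl_exceed2:
  assumes x: "trajectory x n" and jk: "j \<le> n" "k \<le> n" "j \<noteq> k" and st: "0 \<le> s" "0 \<le> t"
  shows "prob {\<omega> \<in> cyl x n. s < tau j \<omega> \<and> t < tau k \<omega>} =
    weight x n * exp (- (q (x j) * s)) * exp (- (q (x k) * t))"
proof -
  \<comment> \<open>Positivity, which is part of \<open>cyl\<close>, is the lower bound 0 for the remaining holding times.\<close>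
  define u where "u i = (if i = j then s else 0) + (if i = k then t else 0)" for i
  have "{\<omega> \<in> cyl x n. s < tau j \<omega> \<and> t < tau k \<omega>} = {\<omega> \<in> space M. \<forall>i\<le>n. Y i \<omega> = x i \<and> u i < tau i \<omega>}"
  proof (intro Collect_cong iffI; clarsimp simp: cyl_def)
    fix \<omega> i assume "s < tau j \<omega>" "t < tau k \<omega>" "\<forall>i\<le>n. Y i \<omega> = x i \<and> 0 < tau i \<omega>" "i \<le> n"
    then show "u i < tau i \<omega>" using jk by (auto simp: u_def)
  next
    fix \<omega> assume *: "\<forall>i\<le>n. Y i \<omega> = x i \<and> u i < tau i \<omega>"
    have less: "u i < tau i \<omega>" if "i \<le> n" for i using * that by blast
    have "0 \<le> u i" for i using st by (simp add: u_def)
    then have "0 < tau i \<omega>" if "i \<le> n" for i using less[OF that] le_less_trans by blast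
    then show "(\<forall>i\<le>n. 0 < tau i \<omega>) \<and> s < tau j \<omega> \<and> t < tau k \<omega>"
      using less[of j] less[of k] jk by (simp add: u_def)
  qed
  moreover have "prob {\<omega> \<in> space M. \<forall>i\<le>n. Y i \<omega> = x i \<and> u i < tau i \<omega>} =
      weight x n * (\<Prod>i\<le>n. exp (- q (x i) * u i))"
    unfolding weight_def using x st by (intro law) (auto simp: trajectory_def u_def)
  moreover have "(\<Prod>i\<le>n. exp (- q (x i) * u i)) = exp (\<Sum>i\<le>n. - q (x i) * u i)"
    by (simp add: exp_sum)
  moreover have "(\<Sum>i\<le>n. - q (x i) * u i) = - (q (x j) * s) + - (q (x k) * t)"
    using jk by (simp add: u_def distrib_left sum.distrib sum_negf if_distrib[of "(*) _"] cong: if_cong)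
  ultimately show ?thesis by (simp only: exp_add mult.assoc)
qed

lemma prob_cyl_exceed:
  assumes x: "trajectory x n" and j: "j \<le> n" and s: "0 \<le> s"
  shows "prob {\<omega> \<in> cyl x n. s < tau j \<omega>} = weight x n * exp (- (q (x j) * s))"
proof -
  define u where "u i = (if i = j then s else 0)" for i
  have "{\<omega> \<in> cyl x n. s < tau j \<omega>} = {\<omega> \<in> space M. \<forall>i\<le>n. Y i \<omega> = x i \<and> u i < tau i \<omega>}"
    using j s by (auto simp: cyl_def u_def intro: le_less_trans split: if_splits)
  moreover have "prob {\<omega> \<in> space M. \<forall>i\<le>n. Y i \<omega> = x i \<and> u i < tau i \<omega>} =
      weight x n * (\<Prod>i\<le>n. exp (- q (x i) * u i))"
    unfolding weight_def using x s by (intro law) (auto simp: trajectory_def u_def)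
  moreover have "(\<Prod>i\<le>n. exp (- q (x i) * u i)) = exp (\<Sum>i\<le>n. - q (x i) * u i)"
    by (simp add: exp_sum)
  moreover have "(\<Sum>i\<le>n. - q (x i) * u i) = - (q (x j) * s)"
    using j by (simp add: u_def sum_negf if_distrib[of "(*) _"] cong: if_cong)
  ultimately show ?thesis by simp
qed

lemma prob_cyl:
  assumes x: "trajectory x n" shows "prob (cyl x n) = weight x n"
proof -
  have "{\<omega> \<in> cyl x n. 0 < tau 0 \<omega>} = cyl x n" by (auto simp: cyl_def)
  then show ?thesis using prob_cyl_exceed[OF x, of 0 0] by simp
qed

lemma weight_nonneg: "trajectory x n \<Longrightarrow> 0 \<le> weight x n"
  using prob_cyl[of x n] measure_nonneg by metis

lemma trajectory_extend: "trajectory x n \<Longrightarrow> y \<in> N (x n) \<Longrightarrow> trajectory (x(Suc n := y)) (Suc n)"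
  using N_subset by (auto simp: trajectory_def le_Suc_eq)

lemma prob_cyl_extend:
  assumes x: "trajectory x n" and y: "y \<in> N (x n)"
  shows "prob (cyl (x(Suc n := y)) (Suc n)) = weight x n * p (x n) y"
proof -
  have "prob (cyl (x(Suc n := y)) (Suc n)) = weight (x(Suc n := y)) (Suc n)"
    by (intro prob_cyl trajectory_extend x y)
  also have "\<dots> = weight x n * p (x n) y"
    by (simp add: weight_def)
  finally show ?thesis .
qed

lemma cyl_extend: "cyl (x(Suc n := y)) (Suc n) = {\<omega> \<in> cyl x n. Y (Suc n) \<omega> = y \<and> 0 < tau (Suc n) \<omega>}"
  by (auto simp: cyl_def le_Suc_eq)

text \<open>The one-step extensions of a cylinder along \<open>N (x n)\<close> are disjoint and, since the transition
  probabilities add up to 1, exhaust its probability.\<close>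

lemma AE_cyl_extend:
  assumes x: "trajectory x n"
  shows "AE \<omega> in M. \<omega> \<in> cyl x n \<longrightarrow> Y (Suc n) \<omega> \<in> N (x n) \<and> 0 < tau (Suc n) \<omega>"
proof -
  have xn: "x n \<in> S" using x by (simp add: trajectory_def)
  define U where "U = (\<Union>y\<in>N (x n). cyl (x(Suc n := y)) (Suc n))"
  have U[measurable]: "U \<in> sets M"
    unfolding U_def using finite_N[OF xn] by (intro sets.finite_UN) auto
  have "U \<subseteq> cyl x n" by (auto simp: U_def cyl_extend)
  have "prob U = (\<Sum>y\<in>N (x n). prob (cyl (x(Suc n := y)) (Suc n)))"
    unfolding U_def
    by (intro finite_measure_finite_Union finite_N xn) (auto simp: disjoint_family_on_def cyl_extend)
  also have "\<dots> = weight x n"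
    using p_sum[OF xn] by (simp add: prob_cyl_extend[OF x] flip: sum_distrib_left)
  finally have "prob (cyl x n - U) = 0"
    using finite_measure_Diff[OF cyl_sets U \<open>U \<subseteq> cyl x n\<close>] prob_cyl[OF x] by simp
  then have "cyl x n - U \<in> null_sets M"
    by (intro null_setsI) (auto simp: emeasure_eq_measure)
  then show ?thesis
    by (rule AE_I') (auto simp: U_def cyl_extend dest: sets.sets_into_space[OF cyl_sets, THEN subsetD])
qed

primrec reach :: "nat \<Rightarrow> 's set" where
  "reach 0 = {x0}"
| "reach (Suc n) = (\<Union>x\<in>reach n. N x)"

definition paths :: "nat \<Rightarrow> (nat \<Rightarrow> 's) set" where
  "paths n = PiE {..n} reach"

lemma reach: "reach n \<subseteq> S" "finite (reach n)"
proof (induction n)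
  case (Suc n)
  { case 1 show ?case using Suc N_subset by fastforce }
  { case 2 show ?case using Suc finite_N by auto }
qed (auto simp: x0)

lemma finite_paths: "finite (paths n)"
  unfolding paths_def by (intro finite_PiE reach) auto

lemma paths_trajectory: "x \<in> paths n \<Longrightarrow> trajectory x n"
  using reach(1) by (auto simp: paths_def trajectory_def PiE_iff subset_iff dest: bspec[of _ _ 0])

text \<open>Only finitely many states can be reached in \<open>n\<close> steps, so the one-step statement for
  cylinders holds almost surely for all paths of length \<open>n\<close> at once.\<close>

lemma AE_chain: "AE \<omega> in M. Y 0 \<omega> = x0 \<and> (\<forall>n. Y (Suc n) \<omega> \<in> N (Y n \<omega>) \<and> 0 < tau n \<omega>)"
proof -
  let ?P = "\<lambda>n \<omega>. Y 0 \<omega> = x0 \<and> (\<forall>i\<le>n. 0 < tau i \<omega>) \<and> (\<forall>i<n. Y (Suc i) \<omega> \<in> N (Y i \<omega>))"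
  have "AE \<omega> in M. ?P n \<omega>" for n
  proof (induction n)
    case 0
    have "prob (cyl (\<lambda>_. x0) 0) = 1"
      using prob_cyl[of "\<lambda>_. x0" 0] x0 by (simp add: trajectory_def weight_def)
    then have "AE \<omega> in M. \<omega> \<in> cyl (\<lambda>_. x0) 0"
      by (simp add: prob_eq_1)
    then show ?case by (rule AE_mp) (auto simp: cyl_def)
  next
    case (Suc n)
    have "AE \<omega> in M. \<forall>x\<in>paths n. \<omega> \<in> cyl x n \<longrightarrow> Y (Suc n) \<omega> \<in> N (x n) \<and> 0 < tau (Suc n) \<omega>"
      using finite_paths by (intro AE_finite_allI AE_cyl_extend paths_trajectory)
    with Suc AE_space show ?case
    proof eventually_elim
      case (elim \<omega>)
      define x where "x = restrict (\<lambda>i. Y i \<omega>) {..n}"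
      have "Y i \<omega> \<in> reach i" if "i \<le> n" for i
        using that by (induction i) (use elim in \<open>auto simp: Suc_le_eq\<close>)
      then have "x \<in> paths n" by (auto simp: paths_def x_def)
      moreover have "\<omega> \<in> cyl x n" using elim by (auto simp: cyl_def x_def)
      ultimately have "Y (Suc n) \<omega> \<in> N (x n) \<and> 0 < tau (Suc n) \<omega>" using elim by blast
      then show ?case using elim by (auto simp: le_Suc_eq less_Suc_eq x_def)
    qed
  qed
  then have "AE \<omega> in M. \<forall>n. ?P n \<omega>" by (simp add: AE_all_countable)
  then show ?thesis by (rule AE_mp) (auto intro!: AE_I2)
qed

text \<open>Almost surely exactly one of the finitely many possible paths of length \<open>n\<close> is followed. Expectations
  can therefore be computed path by path, and the cylinders take the place of conditional
  expectations given the first \<open>n\<close> jumps.\<close>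

lemma AE_sum_indicator_cyl:
  "AE \<omega> in M. (\<Sum>x\<in>paths n. indicator (cyl x n) \<omega> :: 'b :: semiring_1) = 1"
  using AE_chain AE_space
proof eventually_elim
  case (elim \<omega>)
  define x where "x = restrict (\<lambda>i. Y i \<omega>) {..n}"
  have "Y i \<omega> \<in> reach i" for i
    by (induction i) (use elim in auto)
  then have "x \<in> paths n" by (auto simp: paths_def x_def)
  have "indicator (cyl y n) \<omega> = (if x = y then 1 else 0 :: 'b)" if "y \<in> paths n" for y
  proof -
    have "\<omega> \<in> cyl y n \<longleftrightarrow> x = y"
      using that elim by (auto simp: cyl_def x_def paths_def PiE_iff extensional_def fun_eq_iff)
    then show ?thesis by (simp add: indicator_def)
  qed
  then show ?case using finite_paths \<open>x \<in> paths n\<close> by simp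
qed

lemma expectation_zero_if_zero_on_cylinders:
  assumes F: "integrable M F" and zero: "\<And>x. x \<in> paths n \<Longrightarrow> expectation (\<lambda>\<omega>. indicator (cyl x n) \<omega> * F \<omega>) = 0"
  shows "expectation F = (0 :: real)"
proof -
  have int: "integrable M (\<lambda>\<omega>. indicator (cyl x n) \<omega> * F \<omega>)" for x
    using integrable_mult_indicator[OF cyl_sets F, of x n] by simp
  have "expectation F = expectation (\<lambda>\<omega>. \<Sum>x\<in>paths n. indicator (cyl x n) \<omega> * F \<omega>)"
  proof (rule integral_cong_AE)
    show "AE \<omega> in M. F \<omega> = (\<Sum>x\<in>paths n. indicator (cyl x n) \<omega> * F \<omega>)"
      using AE_sum_indicator_cyl[of n, where 'b = real]
      by eventually_elim (simp flip: sum_distrib_right)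
  qed (use F in auto)
  also have "\<dots> = 0" by (simp add: Bochner_Integration.integral_sum int zero)
  finally show ?thesis .
qed

lemma nn_integral_le_if_le_on_cylinders:
  assumes [measurable]: "F \<in> borel_measurable M"
    and le: "\<And>x. x \<in> paths n \<Longrightarrow> (\<integral>\<^sup>+ \<omega>. indicator (cyl x n) \<omega> * F \<omega> \<partial>M) \<le> C * emeasure M (cyl x n)"
  shows "(\<integral>\<^sup>+ \<omega>. F \<omega> \<partial>M) \<le> C"
proof -
  have "(\<integral>\<^sup>+ \<omega>. F \<omega> \<partial>M) = (\<integral>\<^sup>+ \<omega>. (\<Sum>x\<in>paths n. indicator (cyl x n) \<omega> * F \<omega>) \<partial>M)"
  proof (rule nn_integral_cong_AE)
    show "AE \<omega> in M. F \<omega> = (\<Sum>x\<in>paths n. indicator (cyl x n) \<omega> * F \<omega>)"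
      using AE_sum_indicator_cyl[of n, where 'b = ennreal]
      by eventually_elim (simp flip: sum_distrib_right)
  qed
  also have "\<dots> = (\<Sum>x\<in>paths n. \<integral>\<^sup>+ \<omega>. indicator (cyl x n) \<omega> * F \<omega> \<partial>M)"
    by (rule nn_integral_sum) measurable
  also have "\<dots> \<le> (\<Sum>x\<in>paths n. C * (\<integral>\<^sup>+ \<omega>. indicator (cyl x n) \<omega> \<partial>M))"
    using le by (intro sum_mono) simp
  also have "\<dots> = C * (\<integral>\<^sup>+ \<omega>. (\<Sum>x\<in>paths n. indicator (cyl x n) \<omega>) \<partial>M)"
    by (subst nn_integral_sum) (auto simp: sum_distrib_left)
  also have "(\<integral>\<^sup>+ \<omega>. (\<Sum>x\<in>paths n. indicator (cyl x n) \<omega>) \<partial>M) = (\<integral>\<^sup>+ \<omega>. 1 \<partial>M)"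
    by (rule nn_integral_cong_AE) (rule AE_sum_indicator_cyl)
  finally show ?thesis by (simp add: emeasure_space_1)
qed

lemma expectation_cyl_next:
  assumes x: "trajectory x n" 
  shows "expectation (\<lambda>\<omega>. indicator (cyl x n) \<omega> * f (Y (Suc n) \<omega>)) = weight x n * (\<Sum>y\<in>N (x n). p (x n) y * f y)"
proof -
  have xn: "x n \<in> S" using x by (simp add: trajectory_def)
  have "expectation (\<lambda>\<omega>. indicator (cyl x n) \<omega> * f (Y (Suc n) \<omega>)) =
      expectation (\<lambda>\<omega>. \<Sum>y\<in>N (x n). f y * indicator (cyl (x(Suc n := y)) (Suc n)) \<omega>)"
  proof (rule integral_cong_AE)
    show "AE \<omega> in M. indicator (cyl x n) \<omega> * f (Y (Suc n) \<omega>) =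
        (\<Sum>y\<in>N (x n). f y * indicator (cyl (x(Suc n := y)) (Suc n)) \<omega>)"
      using AE_cyl_extend[OF x]
    proof eventually_elim
      case (elim \<omega>)
      have "f y * indicator (cyl (x(Suc n := y)) (Suc n)) \<omega> =
          (if Y (Suc n) \<omega> = y then indicator (cyl x n) \<omega> * f (Y (Suc n) \<omega>) else 0)" for y
        using elim by (auto simp: cyl_extend indicator_def)
      then show ?case using elim finite_N[OF xn] by (auto simp: indicator_def)
    qed
  qed (use Y_function_measurable[of f "Suc n"] in measurable)
  also have "\<dots> = (\<Sum>y\<in>N (x n). f y * prob (cyl (x(Suc n := y)) (Suc n)))"
    by (simp add: Bochner_Integration.integral_sum emeasure_eq_measure)
  also have "\<dots> = weight x n * (\<Sum>y\<in>N (x n). p (x n) y * f y)"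
    by (simp add: prob_cyl_extend[OF x] sum_distrib_left mult_ac)
  finally show ?thesis .
qed

text \<open>For \<open>j < k\<close> the \<open>j\<close>-th term is constant on every cylinder of length \<open>k\<close>, while the \<open>k\<close>-th one, which
  involves one more jump, has mean zero there by \<open>centred\<close>.\<close>

theorem chain_strong_law:
  fixes f :: "'s \<Rightarrow> 's \<Rightarrow> real"
  assumes bound: "\<And>x y. x \<in> S \<Longrightarrow> y \<in> N x \<Longrightarrow> \<bar>f x y\<bar> \<le> B"
    and centred: "\<And>x. x \<in> S \<Longrightarrow> (\<Sum>y\<in>N x. p x y * f x y) = 0"
  shows "AE \<omega> in M. (\<lambda>n. (\<Sum>k<n. f (Y k \<omega>) (Y (Suc k) \<omega>)) / real n) \<longlonglongrightarrow> 0"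
proof (rule orthogonal_strong_law)
  let ?X = "\<lambda>k \<omega>. f (Y k \<omega>) (Y (Suc k) \<omega>)"
  show meas[measurable]: "?X k \<in> borel_measurable M" for k by (rule Y_function2_measurable)
  have AE_B: "AE \<omega> in M. \<bar>?X k \<omega>\<bar> \<le> B" for k
    using AE_chain AE_space by eventually_elim (auto intro: bound Y_in_S)
  have AE_B2: "AE \<omega> in M. (?X k \<omega>)\<^sup>2 \<le> B\<^sup>2" for k
    using AE_B[of k] by eventually_elim (metis abs_ge_zero power2_abs power_mono)
  show int: "integrable M (\<lambda>\<omega>. (?X k \<omega>)\<^sup>2)" for k
    by (rule integrable_const_bound[of _ "B\<^sup>2"]) (use AE_B2 in auto)
  show "expectation (\<lambda>\<omega>. (?X k \<omega>)\<^sup>2) \<le> B\<^sup>2" for k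
    using integral_mono_AE[OF int integrable_const AE_B2] by (simp add: prob_space)
  show "expectation (\<lambda>\<omega>. ?X j \<omega> * ?X k \<omega>) = 0" if "j < k" for j k
  proof (rule expectation_zero_if_zero_on_cylinders[where n = k])
    show "integrable M (\<lambda>\<omega>. ?X j \<omega> * ?X k \<omega>)"
      by (intro integrable_mult_of_squares int meas)
    fix x assume "x \<in> paths k"
    then have x: "trajectory x k" by (rule paths_trajectory)
    have "Y i \<omega> = x i" if "\<omega> \<in> cyl x k" "i \<le> k" for i \<omega> using that by (simp add: cyl_def)
    then have eq: "indicator (cyl x k) \<omega> * (?X j \<omega> * ?X k \<omega>) =
        f (x j) (x (Suc j)) * (indicator (cyl x k) \<omega> * f (x k) (Y (Suc k) \<omega>))" for \<omega>
      using that by (cases "\<omega> \<in> cyl x k") simp_all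
    show "expectation (\<lambda>\<omega>. indicator (cyl x k) \<omega> * (?X j \<omega> * ?X k \<omega>)) = 0"
      unfolding eq using expectation_cyl_next[OF x, of "f (x k)"] centred[of "x k"] x by (simp add: trajectory_def)
  qed
qed

lemma expectation_cyl_tau:
  assumes x: "trajectory x n" and j: "j \<le> n"
  shows "has_bochner_integral M (\<lambda>\<omega>. indicator (cyl x n) \<omega> * tau j \<omega>) (weight x n / q (x j))"
proof (rule has_bochner_integral_nn_integral)
  have qj: "0 < q (x j)" using x j q_pos by (auto simp: trajectory_def)
  have "(\<integral>\<^sup>+ \<omega>. ennreal (indicator (cyl x n) \<omega> * tau j \<omega>) \<partial>M) =
      (\<integral>\<^sup>+ \<omega>. indicator (cyl x n) \<omega> * ennreal (tau j \<omega>) \<partial>M)"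
    by (intro nn_integral_cong) (auto simp: indicator_def)
  also have "\<dots> = (\<integral>\<^sup>+ s. indicator {0..} s * (\<integral>\<^sup>+ \<omega>. indicator (cyl x n) \<omega> * indicator {s<..} (tau j \<omega>) \<partial>M) \<partial>lborel)"
    by (rule nn_integral_layer_cake_weighted) measurable
  also have "\<dots> = (\<integral>\<^sup>+ s. indicator {0..} s * ennreal (weight x n * exp (- (q (x j) * s))) \<partial>lborel)"
  proof (intro nn_integral_cong)
    fix s :: real
    have "(\<integral>\<^sup>+ \<omega>. indicator (cyl x n) \<omega> * indicator {s<..} (tau j \<omega>) \<partial>M) =
        (\<integral>\<^sup>+ \<omega>. indicator {\<omega> \<in> cyl x n. s < tau j \<omega>} \<omega> \<partial>M)"
      by (intro nn_integral_cong) (auto simp: indicator_def)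
    also have "\<dots> = prob {\<omega> \<in> cyl x n. s < tau j \<omega>}"
      by (simp add: emeasure_eq_measure)
    finally show "indicator {0..} s * (\<integral>\<^sup>+ \<omega>. indicator (cyl x n) \<omega> * indicator {s<..} (tau j \<omega>) \<partial>M) =
        indicator {0..} s * ennreal (weight x n * exp (- (q (x j) * s)))"
      using prob_cyl_exceed[OF x j, of s] by (simp add: indicator_def)
  qed
  also have "\<dots> = ennreal (weight x n / q (x j))" by (rule nn_integral_exp_neg[OF qj])
  finally show "(\<integral>\<^sup>+ \<omega>. ennreal (indicator (cyl x n) \<omega> * tau j \<omega>) \<partial>M) = ennreal (weight x n / q (x j))" .
  show "0 \<le> weight x n / q (x j)" using weight_nonneg[OF x] qj by simp
  show "AE \<omega> in M. 0 \<le> indicator (cyl x n) \<omega> * tau j \<omega>"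
    using j by (auto simp: cyl_def indicator_def less_imp_le)
qed measurable

text \<open>The case \<open>j = k\<close> is included and serves for the second moment.\<close>

lemma nn_integral_cyl_tau_tau:
  assumes "trajectory x n" "j \<le> n" "k \<le> n"
  shows "(\<integral>\<^sup>+ \<omega>. ennreal (indicator (cyl x n) \<omega> * (tau j \<omega> * tau k \<omega>)) \<partial>M) =
    (\<integral>\<^sup>+ s. indicator {0..} s * (\<integral>\<^sup>+ t. indicator {0..} t *
       ennreal (prob {\<omega> \<in> cyl x n. s < tau j \<omega> \<and> t < tau k \<omega>}) \<partial>lborel) \<partial>lborel)"
proof -
  have "(\<integral>\<^sup>+ \<omega>. ennreal (indicator (cyl x n) \<omega> * (tau j \<omega> * tau k \<omega>)) \<partial>M) =
      (\<integral>\<^sup>+ \<omega>. (indicator (cyl x n) \<omega> * ennreal (tau k \<omega>)) * ennreal (tau j \<omega>) \<partial>M)"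
    using assms
    by (intro nn_integral_cong) (auto simp: indicator_def cyl_def ennreal_mult less_imp_le mult.commute)
  also have "\<dots> = (\<integral>\<^sup>+ s. indicator {0..} s * (\<integral>\<^sup>+ \<omega>. (indicator (cyl x n) \<omega> * ennreal (tau k \<omega>)) *
      indicator {s<..} (tau j \<omega>) \<partial>M) \<partial>lborel)"
    by (rule nn_integral_layer_cake_weighted) measurable
  also have "\<dots> = (\<integral>\<^sup>+ s. indicator {0..} s * (\<integral>\<^sup>+ \<omega>. (indicator (cyl x n) \<omega> *
      indicator {s<..} (tau j \<omega>)) * ennreal (tau k \<omega>) \<partial>M) \<partial>lborel)"
    by (simp add: mult_ac)
  also have "\<dots> = (\<integral>\<^sup>+ s. indicator {0..} s * (\<integral>\<^sup>+ t. indicator {0..} t *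
       ennreal (prob {\<omega> \<in> cyl x n. s < tau j \<omega> \<and> t < tau k \<omega>}) \<partial>lborel) \<partial>lborel)"
  proof (intro nn_integral_cong arg_cong2[where f = "(*)"] refl)
    fix s :: real
    have "(\<integral>\<^sup>+ \<omega>. (indicator (cyl x n) \<omega> * indicator {s<..} (tau j \<omega>)) * ennreal (tau k \<omega>) \<partial>M) =
        (\<integral>\<^sup>+ t. indicator {0..} t * (\<integral>\<^sup>+ \<omega>. (indicator (cyl x n) \<omega> * indicator {s<..} (tau j \<omega>)) *
           indicator {t<..} (tau k \<omega>) \<partial>M) \<partial>lborel)"
      by (rule nn_integral_layer_cake_weighted) measurable
    also have "\<dots> = (\<integral>\<^sup>+ t. indicator {0..} t *
       ennreal (prob {\<omega> \<in> cyl x n. s < tau j \<omega> \<and> t < tau k \<omega>}) \<partial>lborel)"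
    proof (intro nn_integral_cong arg_cong2[where f = "(*)"] refl)
      fix t :: real
      have "(\<integral>\<^sup>+ \<omega>. (indicator (cyl x n) \<omega> * indicator {s<..} (tau j \<omega>)) * indicator {t<..} (tau k \<omega>) \<partial>M) =
          (\<integral>\<^sup>+ \<omega>. indicator {\<omega> \<in> cyl x n. s < tau j \<omega> \<and> t < tau k \<omega>} \<omega> \<partial>M)"
        by (intro nn_integral_cong) (auto simp: indicator_def)
      then show "(\<integral>\<^sup>+ \<omega>. (indicator (cyl x n) \<omega> * indicator {s<..} (tau j \<omega>)) * indicator {t<..} (tau k \<omega>) \<partial>M) =
          ennreal (prob {\<omega> \<in> cyl x n. s < tau j \<omega> \<and> t < tau k \<omega>})"
        by (simp add: emeasure_eq_measure)
    qed
    finally show "(\<integral>\<^sup>+ \<omega>. (indicator (cyl x n) \<omega> * indicator {s<..} (tau j \<omega>)) * ennreal (tau k \<omega>) \<partial>M) =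
      (\<integral>\<^sup>+ t. indicator {0..} t * ennreal (prob {\<omega> \<in> cyl x n. s < tau j \<omega> \<and> t < tau k \<omega>}) \<partial>lborel)" .
  qed
  finally show ?thesis .
qed

lemma expectation_cyl_tau_tau:
  assumes x: "trajectory x n" and jk: "j \<le> n" "k \<le> n" "j \<noteq> k"
  shows "has_bochner_integral M (\<lambda>\<omega>. indicator (cyl x n) \<omega> * (tau j \<omega> * tau k \<omega>))
    (weight x n / (q (x j) * q (x k)))"
proof (rule has_bochner_integral_nn_integral)
  have q: "0 < q (x j)" "0 < q (x k)" using x jk q_pos by (auto simp: trajectory_def)
  have "(\<integral>\<^sup>+ \<omega>. ennreal (indicator (cyl x n) \<omega> * (tau j \<omega> * tau k \<omega>)) \<partial>M) =
    (\<integral>\<^sup>+ s. indicator {0..} s * (\<integral>\<^sup>+ t. indicator {0..} t *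
       ennreal (weight x n * exp (- (q (x j) * s)) * exp (- (q (x k) * t))) \<partial>lborel) \<partial>lborel)"
    unfolding nn_integral_cyl_tau_tau[OF x jk(1,2)]
  proof (rule nn_integral_cong)
    fix s :: real
    show "indicator {0..} s * (\<integral>\<^sup>+ t. indicator {0..} t *
        ennreal (prob {\<omega> \<in> cyl x n. s < tau j \<omega> \<and> t < tau k \<omega>}) \<partial>lborel) =
      indicator {0..} s * (\<integral>\<^sup>+ t. indicator {0..} t *
        ennreal (weight x n * exp (- (q (x j) * s)) * exp (- (q (x k) * t))) \<partial>lborel)"
    proof (cases "0 \<le> s")
      case True
      then have "(\<integral>\<^sup>+ t. indicator {0..} t * ennreal (prob {\<omega> \<in> cyl x n. s < tau j \<omega> \<and> t < tau k \<omega>}) \<partial>lborel) =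
        (\<integral>\<^sup>+ t. indicator {0..} t * ennreal (weight x n * exp (- (q (x j) * s)) * exp (- (q (x k) * t))) \<partial>lborel)"
        by (intro nn_integral_cong) (auto simp: indicator_def prob_cyl_exceed2[OF x jk])
      then show ?thesis by simp
    qed simp
  qed
  also have "\<dots> = ennreal (weight x n / (q (x j) * q (x k)))" by (rule nn_integral_exp_neg2[OF q])
  finally show "(\<integral>\<^sup>+ \<omega>. ennreal (indicator (cyl x n) \<omega> * (tau j \<omega> * tau k \<omega>)) \<partial>M) =
    ennreal (weight x n / (q (x j) * q (x k)))" .
  show "0 \<le> weight x n / (q (x j) * q (x k))" using weight_nonneg[OF x] q by simp
  show "AE \<omega> in M. 0 \<le> indicator (cyl x n) \<omega> * (tau j \<omega> * tau k \<omega>)"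
    using jk by (auto simp: cyl_def indicator_def less_imp_le)
qed measurable

text \<open>On a cylinder, the event that the holding time exceeds both \<open>s\<close> and \<open>t\<close> has relative probability
  \<open>exp (- q max s t)\<close>, which is at most \<open>exp (- qmin s / 2) exp (- qmin t / 2)\<close>. This crude
  comparison reduces the second moment to the product formula for two different holding times.\<close>

lemma nn_integral_tau_sq: "(\<integral>\<^sup>+ \<omega>. ennreal ((tau n \<omega>)\<^sup>2) \<partial>M) \<le> ennreal (4 / qmin\<^sup>2)"
proof (rule nn_integral_le_if_le_on_cylinders[where n = n])
  fix x assume "x \<in> paths n"
  then have x: "trajectory x n" by (rule paths_trajectory)
  then have q: "qmin \<le> q (x n)" using q_ge by (simp add: trajectory_def)
  have "(\<integral>\<^sup>+ \<omega>. indicator (cyl x n) \<omega> * ennreal ((tau n \<omega>)\<^sup>2) \<partial>M) =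
      (\<integral>\<^sup>+ \<omega>. ennreal (indicator (cyl x n) \<omega> * (tau n \<omega> * tau n \<omega>)) \<partial>M)"
    by (intro nn_integral_cong) (auto simp: indicator_def power2_eq_square)
  also have "\<dots> \<le> (\<integral>\<^sup>+ s. indicator {0..} s * (\<integral>\<^sup>+ t. indicator {0..} t *
       ennreal (weight x n * exp (- (qmin / 2 * s)) * exp (- (qmin / 2 * t))) \<partial>lborel) \<partial>lborel)"
    unfolding nn_integral_cyl_tau_tau[OF x order.refl order.refl]
  proof (rule nn_integral_mono)
    fix s :: real
    show "indicator {0..} s * (\<integral>\<^sup>+ t. indicator {0..} t *
        ennreal (prob {\<omega> \<in> cyl x n. s < tau n \<omega> \<and> t < tau n \<omega>}) \<partial>lborel) \<le>
      indicator {0..} s * (\<integral>\<^sup>+ t. indicator {0..} t *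
        ennreal (weight x n * exp (- (qmin / 2 * s)) * exp (- (qmin / 2 * t))) \<partial>lborel)"
    proof (cases "0 \<le> s")
      case True
      have "prob {\<omega> \<in> cyl x n. s < tau n \<omega> \<and> t < tau n \<omega>} \<le>
          weight x n * exp (- (qmin / 2 * s)) * exp (- (qmin / 2 * t))" if t: "0 \<le> t" for t
      proof -
        have "{\<omega> \<in> cyl x n. s < tau n \<omega> \<and> t < tau n \<omega>} = {\<omega> \<in> cyl x n. max s t < tau n \<omega>}" by auto
        then have "prob {\<omega> \<in> cyl x n. s < tau n \<omega> \<and> t < tau n \<omega>} = weight x n * exp (- (q (x n) * max s t))"
          using prob_cyl_exceed[OF x order.refl, of "max s t"] True by simp
        also have "\<dots> \<le> weight x n * exp (- (qmin / 2 * s) + - (qmin / 2 * t))"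
        proof (intro mult_left_mono weight_nonneg[OF x], simp only: exp_le_cancel_iff)
          have "qmin / 2 * s \<le> qmin / 2 * max s t" "qmin / 2 * t \<le> qmin / 2 * max s t"
            using qmin by (auto intro!: mult_left_mono)
          moreover have "qmin * max s t \<le> q (x n) * max s t"
            using q True by (intro mult_right_mono) auto
          ultimately show "- (q (x n) * max s t) \<le> - (qmin / 2 * s) + - (qmin / 2 * t)" by linarith
        qed
        finally show ?thesis by (simp only: exp_add mult.assoc)
      qed
      then have "(\<integral>\<^sup>+ t. indicator {0..} t * ennreal (prob {\<omega> \<in> cyl x n. s < tau n \<omega> \<and> t < tau n \<omega>}) \<partial>lborel) \<le>
        (\<integral>\<^sup>+ t. indicator {0..} t * ennreal (weight x n * exp (- (qmin / 2 * s)) * exp (- (qmin / 2 * t))) \<partial>lborel)"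
        by (intro nn_integral_mono) (auto simp: indicator_def intro!: ennreal_leI)
      then show ?thesis by (intro mult_left_mono) auto
    qed simp
  qed
  also have "\<dots> = ennreal (weight x n / (qmin / 2 * (qmin / 2)))"
    using qmin by (intro nn_integral_exp_neg2) auto
  also have "weight x n / (qmin / 2 * (qmin / 2)) = 4 / qmin\<^sup>2 * weight x n"
    by (simp add: power2_eq_square)
  finally show "(\<integral>\<^sup>+ \<omega>. indicator (cyl x n) \<omega> * ennreal ((tau n \<omega>)\<^sup>2) \<partial>M) \<le>
      ennreal (4 / qmin\<^sup>2) * emeasure M (cyl x n)"
    using prob_cyl[OF x] weight_nonneg[OF x] by (simp only: emeasure_eq_measure) (subst ennreal_mult[symmetric]; simp)
qed measurable

text \<open>On a cylinder two different holding times are independent exponential variables whose rates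
  are fixed by the path, so the deviations from their means are uncorrelated there.\<close>

theorem holding_times_strong_law:
  "AE \<omega> in M. (\<lambda>n. (\<Sum>k<n. 1 / q (Y k \<omega>) - tau k \<omega>) / real n) \<longlonglongrightarrow> 0"
proof (rule orthogonal_strong_law)
  let ?V = "\<lambda>k \<omega>. 1 / q (Y k \<omega>) - tau k \<omega>"
  have [measurable]: "(\<lambda>\<omega>. 1 / q (Y k \<omega>)) \<in> borel_measurable M" for k
    by (rule Y_function_measurable)
  show meas[measurable]: "?V k \<in> borel_measurable M" for k by measurable
  have int_tau: "integrable M (\<lambda>\<omega>. (tau k \<omega>)\<^sup>2)" for k
    using nn_integral_tau_sq[of k]
    by (intro integrableI_nonneg) (auto simp: order.strict_trans1[OF _ ennreal_less_top] less_top)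
  have tau_le: "expectation (\<lambda>\<omega>. (tau k \<omega>)\<^sup>2) \<le> 4 / qmin\<^sup>2" for k
    using nn_integral_tau_sq[of k] nn_integral_eq_integral[OF int_tau] by simp
  have V_le: "(?V k \<omega>)\<^sup>2 \<le> 2 / qmin\<^sup>2 + 2 * (tau k \<omega>)\<^sup>2" if "\<omega> \<in> space M" for k \<omega>
  proof -
    have "qmin \<le> q (Y k \<omega>)" using q_ge Y_in_S that by blast
    then have "(1 / q (Y k \<omega>))\<^sup>2 \<le> (1 / qmin)\<^sup>2"
      using qmin by (intro power_mono) (auto simp: frac_le)
    moreover have "(a - b)\<^sup>2 \<le> 2 * a\<^sup>2 + 2 * b\<^sup>2" for a b :: real
      using zero_le_power2[of "a + b"] by (simp add: power2_eq_square algebra_simps)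
    then have "(?V k \<omega>)\<^sup>2 \<le> 2 * (1 / q (Y k \<omega>))\<^sup>2 + 2 * (tau k \<omega>)\<^sup>2" .
    ultimately have "(?V k \<omega>)\<^sup>2 \<le> 2 * (1 / qmin)\<^sup>2 + 2 * (tau k \<omega>)\<^sup>2" by linarith
    then show ?thesis by (simp add: power_divide)
  qed
  have int_bd: "integrable M (\<lambda>\<omega>. 2 / qmin\<^sup>2 + 2 * (tau k \<omega>)\<^sup>2)" for k
    using int_tau by simp
  show int: "integrable M (\<lambda>\<omega>. (?V k \<omega>)\<^sup>2)" for k
    by (rule Bochner_Integration.integrable_bound[OF int_bd[of k]])
       (auto intro!: AE_I2 order.trans[OF _ abs_ge_self] V_le)
  show "expectation (\<lambda>\<omega>. (?V k \<omega>)\<^sup>2) \<le> 10 / qmin\<^sup>2" for k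
  proof -
    have "expectation (\<lambda>\<omega>. (?V k \<omega>)\<^sup>2) \<le> expectation (\<lambda>\<omega>. 2 / qmin\<^sup>2 + 2 * (tau k \<omega>)\<^sup>2)"
      by (intro integral_mono int int_bd V_le)
    also have "\<dots> = 2 / qmin\<^sup>2 + 2 * expectation (\<lambda>\<omega>. (tau k \<omega>)\<^sup>2)"
      using int_tau by (simp add: prob_space)
    also have "\<dots> \<le> 2 / qmin\<^sup>2 + 2 * (4 / qmin\<^sup>2)"
      by (intro add_left_mono mult_left_mono tau_le) simp
    finally show ?thesis by simp
  qed
  show "expectation (\<lambda>\<omega>. ?V j \<omega> * ?V k \<omega>) = 0" if "j < k" for j k
  proof (rule expectation_zero_if_zero_on_cylinders[where n = k])
    show "integrable M (\<lambda>\<omega>. ?V j \<omega> * ?V k \<omega>)"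
      by (intro integrable_mult_of_squares int meas)
    fix x assume "x \<in> paths k"
    then have x: "trajectory x k" by (rule paths_trajectory)
    let ?I = "indicator (cyl x k) :: 'w \<Rightarrow> real" and ?a = "1 / q (x j)" and ?b = "1 / q (x k)"
    have "has_bochner_integral M ?I (weight x k)"
      using has_bochner_integral_real_indicator[OF cyl_sets, of x k] prob_cyl[OF x]
      by (simp add: emeasure_eq_measure)
    then have "has_bochner_integral M
        (\<lambda>\<omega>. ?a * ?b * ?I \<omega> - ?a * (?I \<omega> * tau k \<omega>) - ?b * (?I \<omega> * tau j \<omega>) + ?I \<omega> * (tau j \<omega> * tau k \<omega>))
        (?a * ?b * weight x k - ?a * (weight x k / q (x k)) - ?b * (weight x k / q (x j))
          + weight x k / (q (x j) * q (x k)))"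
      using that
      by (intro has_bochner_integral_add has_bochner_integral_diff has_bochner_integral_mult_right
          expectation_cyl_tau expectation_cyl_tau_tau x) auto
    moreover have "?I \<omega> * (?V j \<omega> * ?V k \<omega>) =
        ?a * ?b * ?I \<omega> - ?a * (?I \<omega> * tau k \<omega>) - ?b * (?I \<omega> * tau j \<omega>) + ?I \<omega> * (tau j \<omega> * tau k \<omega>)" for \<omega>
      using that by (auto simp: cyl_def indicator_def algebra_simps)
    ultimately show "expectation (\<lambda>\<omega>. ?I \<omega> * (?V j \<omega> * ?V k \<omega>)) = 0"
      by (simp add: has_bochner_integral_integral_eq)
  qed
qed

end

section \<open>Linear equations on finite index sets\<close>

text \<open>The Fredholm alternative: a linear system is solvable unless some combination \<open>p\<close> of its rows
  annihilates the matrix but not the right-hand side. The proof is Gaussian elimination of one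
  unknown at a time; solutions and obstructions of the reduced system both lift back.\<close>

lemma linear_system_alternative:
  fixes a :: "'i \<Rightarrow> 'j \<Rightarrow> real"
  assumes "finite J" "finite I"
  shows "(\<exists>f. \<forall>i\<in>I. (\<Sum>j\<in>J. a i j * f j) = b i) \<or>
         (\<exists>p. (\<forall>j\<in>J. (\<Sum>i\<in>I. p i * a i j) = 0) \<and> (\<Sum>i\<in>I. p i * b i) \<noteq> 0)"
  using assms(1)
proof (induction J arbitrary: a b rule: finite_induct)
  case empty
  show ?case
  proof (cases "\<forall>i\<in>I. b i = 0")
    case False
    then obtain i0 where "i0 \<in> I" "b i0 \<noteq> 0" by blast
    then have "(\<Sum>i\<in>I. indicator {i0} i * b i) \<noteq> 0"
      using \<open>finite I\<close> by (simp add: indicator_def if_distrib[of "\<lambda>x. x * _"] cong: if_cong)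
    then show ?thesis by auto
  qed auto
next
  case (insert j J)
  show ?case
  proof (cases "\<forall>i\<in>I. a i j = 0")
    case True
    then show ?thesis using insert.IH[of a b] insert.hyps by simp
  next
    case False
    then obtain i0 where i0: "i0 \<in> I" "a i0 j \<noteq> 0" by blast
    \<comment> \<open>Subtracting \<open>r i\<close> times row \<open>i0\<close> from row \<open>i\<close> removes the unknown \<open>j\<close>; row \<open>i0\<close> itself
      becomes trivial.\<close>
    define r where "r i = a i j / a i0 j" for i
    from insert.IH[of "\<lambda>i k. a i k - r i * a i0 k" "\<lambda>i. b i - r i * b i0"] show ?thesis
    proof (elim disjE exE conjE)
      fix f assume f: "\<forall>i\<in>I. (\<Sum>k\<in>J. (a i k - r i * a i0 k) * f k) = b i - r i * b i0"
      define c where "c = (b i0 - (\<Sum>k\<in>J. a i0 k * f k)) / a i0 j"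
      have "(\<Sum>k\<in>insert j J. a i k * (f(j := c)) k) = b i" if "i \<in> I" for i
      proof -
        have "(\<Sum>k\<in>insert j J. a i k * (f(j := c)) k) = a i j * c + (\<Sum>k\<in>J. a i k * f k)"
          using insert.hyps by (simp, intro sum.cong) auto
        moreover have "(\<Sum>k\<in>J. a i k * f k) = b i - r i * b i0 + r i * (\<Sum>k\<in>J. a i0 k * f k)"
          using f[rule_format, OF that] by (simp add: left_diff_distrib sum_subtractf sum_distrib_left mult.assoc)
        moreover have "a i j * c = r i * (b i0 - (\<Sum>k\<in>J. a i0 k * f k))"
          by (simp add: c_def r_def)
        ultimately show ?thesis by (simp add: algebra_simps)
      qed
      then show ?thesis by blast
    next
      fix p assume p: "\<forall>k\<in>J. (\<Sum>i\<in>I. p i * (a i k - r i * a i0 k)) = 0"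
        "(\<Sum>i\<in>I. p i * (b i - r i * b i0)) \<noteq> 0"
      \<comment> \<open>The multiples of row \<open>i0\<close> that were subtracted are collected in its own coefficient.\<close>
      define p' where "p' i = p i - (if i = i0 then (\<Sum>i\<in>I. p i * r i) else 0)" for i
      have p': "(\<Sum>i\<in>I. p' i * g i) = (\<Sum>i\<in>I. p i * (g i - r i * g i0))" for g
      proof -
        have "(\<Sum>i\<in>I. p' i * g i) = (\<Sum>i\<in>I. p i * g i) - (\<Sum>i\<in>I. p i * r i) * g i0"
          using i0 \<open>finite I\<close>
          by (simp add: p'_def left_diff_distrib sum_subtractf if_distrib[of "\<lambda>x. x * _"] cong: if_cong)
        then show ?thesis
          by (simp add: right_diff_distrib sum_subtractf sum_distrib_right mult.assoc)
      qed
      have "(\<Sum>i\<in>I. p' i * a i k) = 0" if "k \<in> insert j J" for k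
        using that i0 p(1) unfolding p' by (auto simp: r_def)
      then show ?thesis using p(2) unfolding p'[symmetric] by blast
    qed
  qed
qed

section \<open>Representatives modulo integer translations\<close>

lemma rep_translate:
  obtains n where "n \<in> int_lattice" "x = rep x + n"
proof
  show "(\<chi> i. of_int \<lfloor>x $ i\<rfloor>) \<in> int_lattice" by (simp add: int_lattice_def)
  show "x = rep x + (\<chi> i. of_int \<lfloor>x $ i\<rfloor>)" by (simp add: vec_eq_iff rep_def frac_def)
qed

lemma int_lattice_uminus: "n \<in> int_lattice \<Longrightarrow> - n \<in> int_lattice"
  by (simp add: int_lattice_def)

lemma rep_Sbar: "x \<in> Sbar S \<Longrightarrow> rep x = x"
  by (simp add: Sbar_def rep_def vec_eq_iff frac_eq)

lemma rep_add_lattice: "n \<in> int_lattice \<Longrightarrow> rep (x + n) = rep x"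
  by (auto simp: rep_def vec_eq_iff int_lattice_def frac_def Ints_def)

lemma rep_rep_add: "rep (rep x + z) = rep (x + z)"
proof -
  obtain n where n: "n \<in> int_lattice" "x = rep x + n" by (rule rep_translate)
  have "rep (rep x + z) = rep (rep x + z + n)" by (rule rep_add_lattice[OF n(1), symmetric])
  also have "rep x + z + n = rep x + n + z" by (simp add: ac_simps)
  finally show ?thesis unfolding n(2)[symmetric] .
qed

section \<open>The generator on the quotient graph\<close>

context periodic_graph
begin

lemma rep_in_Sbar: assumes "x \<in> S" shows "rep x \<in> Sbar S"
proof -
  obtain n where n: "n \<in> int_lattice" "x = rep x + n" by (rule rep_translate)
  have "rep x = x + (- n)" using n(2) by (metis add.commute add_minus_cancel minus_add_cancel)
  also have "\<dots> \<in> S" by (intro S_translate int_lattice_uminus n assms)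
  finally show ?thesis by (auto simp: Sbar_def rep_def frac_lt_1)
qed

lemma out_edges_translate:
  assumes n: "n \<in> int_lattice"
  shows "out_edges E (x + n) = (\<lambda>e. (fst e + n, snd e + n)) ` out_edges E x"
proof (intro equalityI subsetI)
  fix e assume e: "e \<in> out_edges E (x + n)"
  then have "(fst e + - n, snd e + - n) \<in> E"
    by (intro E_translate int_lattice_uminus n) (cases e, simp add: out_edges_def)
  with e show "e \<in> (\<lambda>e. (fst e + n, snd e + n)) ` out_edges E x"
    by (intro image_eqI[of _ _ "(fst e + - n, snd e + - n)"]) (auto simp: out_edges_def prod_eq_iff)
qed (auto simp: out_edges_def intro!: E_translate n)

text \<open>Rates and displacements are invariant under integer translations, so every sum over outgoing edges
  that depends on nothing else is a function on the quotient.\<close>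

lemma sum_out_edges_translate:
  fixes g :: "real ^ 'd \<Rightarrow> _ \<Rightarrow> 'c :: comm_monoid_add"
  assumes n: "n \<in> int_lattice"
  shows "(\<Sum>e\<in>out_edges E (x + n). g (nu e) (lam e)) = (\<Sum>e\<in>out_edges E x. g (nu e) (lam e))"
proof -
  have "inj_on (\<lambda>e. (fst e + n, snd e + n)) (out_edges E x)"
    by (auto intro!: inj_onI simp: prod_eq_iff)
  moreover have "nu (fst e + n, snd e + n) = nu e" for e :: "'d edge"
    by (simp add: nu_def)
  moreover have "lam (fst e + n, snd e + n) = lam e" if "e \<in> out_edges E x" for e
    using that lam_translate[OF n, of "fst e" "snd e"] by (cases e, simp add: out_edges_def)
  ultimately show ?thesis
    by (simp add: out_edges_translate[OF n] sum.reindex)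
qed

lemma sum_out_edges_rep:
  fixes g :: "real ^ 'd \<Rightarrow> _ \<Rightarrow> 'c :: comm_monoid_add"
  shows   "(\<Sum>e\<in>out_edges E x. g (nu e) (lam e)) = (\<Sum>e\<in>out_edges E (rep x). g (nu e) (lam e))"
proof -
  obtain n where n: "n \<in> int_lattice" "x = rep x + n" by (rule rep_translate)
  show ?thesis using sum_out_edges_translate[OF n(1), of g "rep x"] unfolding n(2)[symmetric] .
qed

lemma exit_rate_rep: "exit_rate E lam x = exit_rate E lam (rep x)"
  unfolding exit_rate_def by (rule sum_out_edges_rep)

lemma drift_rep: "drift E lam x = drift E lam (rep x)"
  unfolding drift_def by (rule sum_out_edges_rep)

lemma gen_rep_eq:
  "gen E lam f (rep x) = (\<Sum>e\<in>out_edges E x. (f (rep (x + nu e)) - f (rep x)) * lam e)"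
  unfolding gen_def rep_rep_add
  by (rule sum_out_edges_rep[of "\<lambda>v l. (f (rep (x + v)) - f (rep x)) * l", symmetric])

lemma finite_out_edges: assumes "x \<in> S" shows "finite (out_edges E x)"
proof -
  have "out_edges E (rep x) \<subseteq> Ebar S E" using rep_in_Sbar[OF assms] by (auto simp: Ebar_def)
  then have "finite (out_edges E (rep x))" using finite_Ebar by (rule finite_subset)
  moreover obtain n where n: "n \<in> int_lattice" "x = rep x + n" by (rule rep_translate)
  ultimately show ?thesis
    using out_edges_translate[OF n(1), of "rep x"] unfolding n(2)[symmetric] by simp
qed

lemma out_edges_nonempty: assumes "x \<in> S" shows "out_edges E x \<noteq> {}"
proof -
  \<comment> \<open>Translating by the vector of ones gives a second node, and a path from \<open>x\<close> to it starts
    with an edge at \<open>x\<close>.\<close>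
  have "(1 :: real ^ 'd) \<in> int_lattice" by (simp add: int_lattice_def)
  then have "(x, x + 1) \<in> E\<^sup>*" using assms by (intro strongly_connected S_translate)
  moreover have "x \<noteq> x + 1" by (simp add: vec_eq_iff)
  ultimately obtain y where "(x, y) \<in> E" by (meson converse_rtranclE)
  then show ?thesis by (auto simp: out_edges_def)
qed

lemma exit_rate_pos: "x \<in> S \<Longrightarrow> 0 < exit_rate E lam x"
  unfolding exit_rate_def
  by (intro sum_pos finite_out_edges out_edges_nonempty lam_pos) (auto simp: out_edges_def)

lemma rep_out_edge: "e \<in> out_edges E x \<Longrightarrow> rep (x + nu e) \<in> Sbar S"
  using E_subset by (auto simp: out_edges_def nu_def intro!: rep_in_Sbar)

text \<open>Strong connectivity of the graph makes the quotient irreducible: the points of \<open>S\<close> whose representative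
  lies in \<open>A\<close> form a set that no edge leaves.\<close>

lemma closed_subset_Sbar:
  assumes "A \<subseteq> Sbar S" "A \<noteq> {}"
    and closed: "\<And>y e. y \<in> A \<Longrightarrow> e \<in> out_edges E y \<Longrightarrow> rep (y + nu e) \<in> A"
  shows "A = Sbar S"
proof (rule subset_antisym[OF assms(1)], rule subsetI)
  obtain x where x: "x \<in> A" using assms by blast
  fix z assume z: "z \<in> Sbar S"
  have "(x, z) \<in> E\<^sup>*" using x z assms by (intro strongly_connected) (auto simp: Sbar_def)
  then have "rep z \<in> A"
  proof (induction rule: rtrancl_induct)
    case base
    show ?case using x assms(1) rep_Sbar[of x S] by auto
  next
    case (step u v)
    obtain n where n: "n \<in> int_lattice" "u = rep u + n" by (rule rep_translate)
    have "(u + - n, v + - n) \<in> E" by (intro E_translate int_lattice_uminus n step)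
    moreover have "u + - n = rep u" using n(2) by (metis add_diff_cancel_right' diff_conv_add_uminus)
    ultimately have "rep (rep u + nu (rep u, v + - n)) \<in> A"
      by (intro closed[OF step.IH]) (simp add: out_edges_def)
    then show ?case by (simp add: nu_def rep_add_lattice[OF int_lattice_uminus[OF n(1)]] del: add_uminus_conv_diff)
  qed
  then show "z \<in> A" using rep_Sbar[OF z] by simp
qed

lemma gen_matrix:
  assumes y: "y \<in> Sbar S"
  shows "(\<Sum>z\<in>Sbar S. gen E lam (indicator {z}) y * f z) = gen E lam f y"
proof -
  have ind: "(\<Sum>z\<in>Sbar S. indicator {z} u * f z) = f u" if "u \<in> Sbar S" for u
    using that finite_Sbar by (simp add: indicator_def if_distrib[of "\<lambda>x. x * _"] cong: if_cong)
  have "(\<Sum>z\<in>Sbar S. gen E lam (indicator {z}) y * f z) =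
      (\<Sum>e\<in>out_edges E y. \<Sum>z\<in>Sbar S. (indicator {z} (rep (y + nu e)) - indicator {z} y) * lam e * f z)"
    unfolding gen_def by (simp add: sum_distrib_right sum.swap[of _ "Sbar S"])
  also have "\<dots> = (\<Sum>e\<in>out_edges E y. ((\<Sum>z\<in>Sbar S. indicator {z} (rep (y + nu e)) * f z)
      - (\<Sum>z\<in>Sbar S. indicator {z} y * f z)) * lam e)"
    by (intro sum.cong refl) (simp add: algebra_simps sum_distrib_left sum_subtractf)
  also have "\<dots> = gen E lam f y"
    unfolding gen_def by (intro sum.cong refl) (simp add: ind y rep_out_edge)
  finally show ?thesis .
qed

text \<open>This is the duality between \<open>gen\<close> and \<open>gen_transpose\<close>, which are otherwise linked only
  through matrix entries.\<close>

lemma sum_gen_transpose: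
  "(\<Sum>y\<in>Sbar S. p y * gen E lam f y) = (\<Sum>z\<in>Sbar S. gen_transpose S E lam p z * f z)"
proof -
  have "(\<Sum>y\<in>Sbar S. p y * gen E lam f y) =
      (\<Sum>y\<in>Sbar S. \<Sum>z\<in>Sbar S. gen E lam (indicator {z}) y * p y * f z)"
    by (simp add: gen_matrix[symmetric] sum_distrib_left mult_ac)
  also have "\<dots> = (\<Sum>z\<in>Sbar S. gen_transpose S E lam p z * f z)"
    unfolding gen_transpose_def sum_distrib_right by (rule sum.swap)
  finally show ?thesis .
qed

lemma gen_range_alternative:
  "(\<exists>f. \<forall>y\<in>Sbar S. gen E lam f y = g y) \<or>
   (\<exists>p. (\<forall>z\<in>Sbar S. gen_transpose S E lam p z = 0) \<and> (\<Sum>y\<in>Sbar S. p y * g y) \<noteq> 0)"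
proof -
  have "gen_transpose S E lam p z = (\<Sum>y\<in>Sbar S. p y * gen E lam (indicator {z}) y)" for p z
    unfolding gen_transpose_def by (simp add: mult.commute)
  then show ?thesis
    using linear_system_alternative[OF finite_Sbar finite_Sbar, of "\<lambda>y z. gen E lam (indicator {z}) y" g]
    by (simp add: gen_matrix)
qed

text \<open>Pair the invariant function \<open>q\<close> with the indicator of \<open>A = {q > 0}\<close>. Applied to this indicator, the
  generator is nonpositive on \<open>A\<close> and nonnegative off \<open>A\<close>, so every term of the pairing is
  nonpositive. As the pairing vanishes, so does each term, which means that no edge leaves
  \<open>A\<close>. By irreducibility \<open>A\<close> is empty or everything; either way a function of total mass zero
  must vanish.\<close>

lemma invariant_sum_zero:
  assumes inv: "\<forall>z\<in>Sbar S. gen_transpose S E lam q z = 0"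
    and sum0: "(\<Sum>y\<in>Sbar S. q y) = 0"
    and y: "y \<in> Sbar S"
  shows "q y = 0"
proof -
  define A where "A = {y \<in> Sbar S. 0 < q y}"
  have nonpos: "q u * gen E lam (indicator A) u \<le> 0" if "u \<in> Sbar S" for u
  proof (cases "u \<in> A")
    case True
    then have "gen E lam (indicator A) u \<le> 0"
      unfolding gen_def by (intro sum_nonpos mult_nonpos_nonneg) (auto simp: indicator_def out_edges_def lam_pos less_imp_le)
    then show ?thesis using True by (auto simp: A_def mult_nonneg_nonpos)
  next
    case False
    then have "gen E lam (indicator A) u \<ge> 0"
      unfolding gen_def by (intro sum_nonneg mult_nonneg_nonneg) (auto simp: indicator_def out_edges_def lam_pos less_imp_le)
    then show ?thesis using False that by (auto simp: A_def mult_nonpos_nonneg)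
  qed
  have "(\<Sum>u\<in>Sbar S. q u * gen E lam (indicator A) u) = 0"
    using inv by (simp add: sum_gen_transpose)
  then have zero: "q u * gen E lam (indicator A) u = 0" if "u \<in> Sbar S" for u
    using sum_nonneg_eq_0_iff[OF finite_Sbar, of "\<lambda>u. - (q u * gen E lam (indicator A) u)"] nonpos that
    by (simp add: sum_negf)
  have closed: "rep (u + nu e) \<in> A" if u: "u \<in> A" and e: "e \<in> out_edges E u" for u e
  proof (rule ccontr)
    assume "rep (u + nu e) \<notin> A"
    then have "0 < (\<Sum>e\<in>out_edges E u. - ((indicator A (rep (u + nu e)) - indicator A u) * lam e))"
      using u e lam_pos lam_pos[THEN less_imp_le]
      by (intro sum_pos2[OF finite_out_edges e]) (auto simp: indicator_def out_edges_def A_def Sbar_def)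
    then have "gen E lam (indicator A) u < 0"
      by (simp add: gen_def sum_negf)
    then show False using zero[of u] u by (auto simp: A_def)
  qed
  have "A = {}"
  proof (rule ccontr)
    assume "A \<noteq> {}"
    then have "A = Sbar S" by (intro closed_subset_Sbar closed) (auto simp: A_def)
    then have "0 < (\<Sum>y\<in>Sbar S. q y)"
      using finite_Sbar y by (intro sum_pos) (auto simp: A_def)
    then show False using sum0 by simp
  qed
  then have "\<forall>u\<in>Sbar S. q u \<le> 0" by (auto simp: A_def not_less)
  then show ?thesis using sum_nonneg_eq_0_iff[OF finite_Sbar, of "\<lambda>u. - q u"] sum0 y by (simp add: sum_negf)
qed

lemma invariant_unique:
  assumes p: "\<forall>z\<in>Sbar S. gen_transpose S E lam p z = 0"
    and q: "\<forall>z\<in>Sbar S. gen_transpose S E lam q z = 0" "(\<Sum>y\<in>Sbar S. q y) = 1"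
    and y: "y \<in> Sbar S"
  shows "p y = (\<Sum>y\<in>Sbar S. p y) * q y"
proof -
  define c where "c = (\<Sum>y\<in>Sbar S. p y)"
  have "gen_transpose S E lam (\<lambda>y. p y - c * q y) z = gen_transpose S E lam p z - c * gen_transpose S E lam q z" for z
    unfolding gen_transpose_def by (simp add: sum_distrib_left algebra_simps sum_subtractf)
  moreover have "(\<Sum>y\<in>Sbar S. p y - c * q y) = 0"
    using q(2) by (simp add: sum_subtractf c_def flip: sum_distrib_left)
  ultimately have "p y - c * q y = 0"
    by (intro invariant_sum_zero[where q = "\<lambda>y. p y - c * q y", OF _ _ y]) (simp_all add: p q(1))
  then show ?thesis by (simp add: c_def)
qed

text \<open>At a maximum of \<open>f\<close> the generator is nonpositive. Via the Fredholm alternative this produces an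
  invariant function with nonzero total mass, hence the stationary distribution.\<close>

lemma no_function_with_gen_one: "\<exists>y\<in>Sbar S. gen E lam f y \<noteq> 1" if "Sbar S \<noteq> {}"
proof -
  have "Max (f ` Sbar S) \<in> f ` Sbar S" using finite_Sbar that by (intro Max_in) auto
  then obtain y where "y \<in> Sbar S" "f y = Max (f ` Sbar S)" by auto
  then have y: "y \<in> Sbar S" "\<forall>z\<in>Sbar S. f z \<le> f y" using finite_Sbar by auto
  then have "gen E lam f y \<le> 0"
    unfolding gen_def
    by (intro sum_nonpos mult_nonpos_nonneg) (auto simp: rep_out_edge out_edges_def lam_pos less_imp_le)
  then show ?thesis using y by force
qed

text \<open>The definite description in \<open>stat_dist\<close> is meaningful: existence comes from the Fredholm alternative
  for the constant right-hand side 1, uniqueness from \<open>invariant_unique\<close>.\<close>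

lemma stat_dist_properties:
  assumes "S \<noteq> {}"
  shows "z \<in> Sbar S \<Longrightarrow> gen_transpose S E lam (stat_dist S E lam) z = 0"
    and "(\<Sum>y\<in>Sbar S. stat_dist S E lam y) = 1"
proof -
  let ?P = "\<lambda>p. p \<in> extensional (Sbar S) \<and> (\<forall>z\<in>Sbar S. gen_transpose S E lam p z = 0) \<and> (\<Sum>y\<in>Sbar S. p y) = 1"
  have ne: "Sbar S \<noteq> {}" using assms rep_in_Sbar by blast
  obtain p where p: "\<forall>z\<in>Sbar S. gen_transpose S E lam p z = 0" "(\<Sum>y\<in>Sbar S. p y) \<noteq> 0"
    using gen_range_alternative[of "\<lambda>_. 1"] no_function_with_gen_one[OF ne] by auto
  define p' where "p' = restrict (\<lambda>y. p y / (\<Sum>y\<in>Sbar S. p y)) (Sbar S)"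
  have "gen_transpose S E lam p' z = 0" if "z \<in> Sbar S" for z
  proof -
    have "gen_transpose S E lam p' z = gen_transpose S E lam p z / (\<Sum>y\<in>Sbar S. p y)"
      unfolding gen_transpose_def p'_def by (simp add: sum_divide_distrib)
    then show ?thesis using p that by simp
  qed
  moreover have "(\<Sum>y\<in>Sbar S. p' y) = 1"
    using p(2) by (simp add: p'_def flip: sum_divide_distrib)
  ultimately have "?P p'" by (auto simp: p'_def)
  moreover have "q = p'" if "?P q" for q
  proof (rule extensionalityI)
    fix y assume y: "y \<in> Sbar S"
    have "q y = (\<Sum>y\<in>Sbar S. q y) * p' y"
      using \<open>?P q\<close> \<open>?P p'\<close> by (intro invariant_unique[OF _ _ _ y]) auto
    then show "q y = p' y" using \<open>?P q\<close> by simp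
  qed (use \<open>?P q\<close> \<open>?P p'\<close> in auto)
  ultimately have "?P (stat_dist S E lam)"
    unfolding stat_dist_def by (rule theI)
  then show "z \<in> Sbar S \<Longrightarrow> gen_transpose S E lam (stat_dist S E lam) z = 0"
    and "(\<Sum>y\<in>Sbar S. stat_dist S E lam y) = 1" by auto
qed

text \<open>Invariant functions are multiples of the stationary distribution, so the mean of \<open>g\<close> under it is the
  only obstruction in the Fredholm alternative.\<close>

lemma poisson_equation:
  assumes "S \<noteq> {}" and centred: "(\<Sum>y\<in>Sbar S. stat_dist S E lam y * g y) = 0"
  obtains f where "\<And>y. y \<in> Sbar S \<Longrightarrow> gen E lam f y = g y"
proof -
  have "(\<Sum>y\<in>Sbar S. p y * g y) = 0" if p: "\<forall>z\<in>Sbar S. gen_transpose S E lam p z = 0" for p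
  proof -
    define c where "c = (\<Sum>y\<in>Sbar S. p y)"
    have "p y = c * stat_dist S E lam y" if "y \<in> Sbar S" for y
      unfolding c_def using stat_dist_properties[OF \<open>S \<noteq> {}\<close>]
      by (intro invariant_unique[OF p _ _ that]) auto
    then have "(\<Sum>y\<in>Sbar S. p y * g y) = (\<Sum>y\<in>Sbar S. c * (stat_dist S E lam y * g y))"
      by (intro sum.cong refl) (simp add: mult.assoc)
    then show ?thesis using centred by (simp flip: sum_distrib_left)
  qed
  then show thesis using gen_range_alternative[of g] that by blast
qed

lemma corrector:
  assumes "S \<noteq> {}"
  obtains f where "\<And>y. y \<in> Sbar S \<Longrightarrow> drift E lam y $ i + gen E lam f y = Ubar S E lam $ i"
proof -
  have "(\<Sum>y\<in>Sbar S. stat_dist S E lam y * (Ubar S E lam $ i - drift E lam y $ i)) = 0"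
    using stat_dist_properties(2)[OF assms]
    by (simp add: right_diff_distrib sum_subtractf Ubar_def flip: sum_distrib_right)
  from poisson_equation[OF assms this]
  obtain f where f: "\<And>y. y \<in> Sbar S \<Longrightarrow> gen E lam f y = Ubar S E lam $ i - drift E lam y $ i"
    by blast
  show thesis by (rule that[of f]) (simp add: f)
qed

end

section \<open>From jump times to all times\<close>

text \<open>Here \<open>T n\<close> is the time of the \<open>n\<close>-th jump and \<open>r n\<close> stands for the mean of the
  holding time \<open>tau n\<close>. Since \<open>T n\<close> is the sum of the \<open>r k\<close> up to \<open>o(n)\<close>, it is at least \<open>(c / 2) n\<close> eventually,
  and a single holding time \<open>tau n\<close> is \<open>o(n)\<close>. For \<open>t\<close> between \<open>T n\<close> and \<open>T (Suc n)\<close> the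
  distance from \<open>z t\<close> to \<open>t U\<close> is thus \<open>o(n)\<close>, and \<open>n\<close> is at most a multiple of \<open>t\<close>.\<close>

lemma jump_path_asymptotics:
  fixes y :: "nat \<Rightarrow> 'a :: real_normed_vector" and tau r :: "nat \<Rightarrow> real" and z :: "real \<Rightarrow> 'a" and U :: 'a
  defines "T \<equiv> \<lambda>n. \<Sum>k<n. tau k"
  assumes tau_pos: "\<And>n. 0 < tau n"
    and r: "\<And>n. c \<le> r n" "\<And>n. r n \<le> C" "0 < c"
    and times: "(\<lambda>n. (\<Sum>k<n. r k - tau k) / real n) \<longlonglongrightarrow> 0"
    and positions: "(\<lambda>n. (y n - T n *\<^sub>R U) /\<^sub>R real n) \<longlonglongrightarrow> 0"
    and z: "\<And>n t. T n \<le> t \<Longrightarrow> t < T (Suc n) \<Longrightarrow> z t = y n"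
  shows "((\<lambda>t. z t /\<^sub>R t) \<longlongrightarrow> U) at_top"
proof -
  define D where "D n = (\<Sum>k<n. r k - tau k)" for n
  have T0: "T 0 = 0" by (simp add: T_def)
  have T_Suc: "T (Suc n) = T n + tau n" for n by (simp add: T_def)
  have T_mono: "m \<le> n \<Longrightarrow> T m \<le> T n" for m n
    by (rule lift_Suc_mono_le[of T]) (simp_all add: T_Suc tau_pos less_imp_le)
  have D0: "(\<lambda>n. D n / real n) \<longlonglongrightarrow> 0" using times unfolding D_def .
  have T_ge: "c * real n - D n \<le> T n" for n
    using sum_mono[of "{..<n}" "\<lambda>_. c" r] r(1) by (simp add: D_def T_def sum_subtractf mult.commute)
  have "\<forall>\<^sub>F n in sequentially. \<bar>D n / real n\<bar> < c / 2"
    using tendstoD[OF D0, of "c / 2"] r(3) by simp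
  with eventually_gt_at_top[of 0] have T_lin: "\<forall>\<^sub>F n in sequentially. c / 2 * real n \<le> T n"
  proof eventually_elim
    case (elim n)
    then have "\<bar>D n\<bar> < c / 2 * real n" by (simp add: abs_divide pos_divide_less_eq)
    then show ?case using T_ge[of n] by linarith
  qed
  have tau_lim: "(\<lambda>n. tau n / real n) \<longlonglongrightarrow> 0"
  proof -
    have D_Suc: "(\<lambda>n. D (Suc n) / real n) \<longlonglongrightarrow> 0"
    proof -
      have "(\<lambda>n. D (Suc n) / real (Suc n) * (real (Suc n) / real n)) \<longlonglongrightarrow> 0 * 1"
        by (rule tendsto_mult[OF LIMSEQ_Suc[OF D0] LIMSEQ_Suc_n_over_n])
      moreover have "D (Suc n) / real (Suc n) * (real (Suc n) / real n) = D (Suc n) / real n" for n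
        by (simp del: of_nat_Suc)
      ultimately show ?thesis by (simp only: mult_zero_left)
    qed
    have "(\<lambda>n. \<bar>C\<bar> / real n + \<bar>D n / real n\<bar> + \<bar>D (Suc n) / real n\<bar>) \<longlonglongrightarrow> 0 + \<bar>0\<bar> + \<bar>0\<bar>"
      by (intro tendsto_add tendsto_rabs D0 D_Suc lim_const_over_n)
    then have lim: "(\<lambda>n. \<bar>C\<bar> / real n + \<bar>D n / real n\<bar> + \<bar>D (Suc n) / real n\<bar>) \<longlonglongrightarrow> 0" by simp
    have "norm (tau n / real n) \<le> \<bar>C\<bar> / real n + \<bar>D n / real n\<bar> + \<bar>D (Suc n) / real n\<bar>" for n
    proof -
      have "tau n = r n + D n - D (Suc n)" by (simp add: D_def)
      moreover have "0 \<le> r n" using r(1)[of n] r(3) by linarith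
      ultimately have "\<bar>tau n\<bar> \<le> \<bar>C\<bar> + \<bar>D n\<bar> + \<bar>D (Suc n)\<bar>" using r(2)[of n] by linarith
      then have "\<bar>tau n\<bar> / real n \<le> (\<bar>C\<bar> + \<bar>D n\<bar> + \<bar>D (Suc n)\<bar>) / real n" by (intro divide_right_mono) auto
      then show ?thesis by (simp add: add_divide_distrib abs_divide)
    qed
    then show ?thesis by (intro Lim_null_comparison[OF _ lim]) auto
  qed
  \<comment> \<open>Relative error on the whole interval between two jumps: at its left end, plus what \<open>t U\<close>
    gains during the holding time.\<close>
  define err where "err n = norm ((y n - T n *\<^sub>R U) /\<^sub>R real n) + tau n / real n * norm U" for n
  have err: "err \<longlonglongrightarrow> 0"
    using tendsto_add[OF tendsto_norm_zero[OF positions] tendsto_mult_left_zero[OF tau_lim, of "norm U"]]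
    by (simp add: err_def[abs_def])
  have unbounded: "\<exists>m. t < T m" for t
  proof -
    obtain n0 where n0: "\<And>n. n0 \<le> n \<Longrightarrow> c / 2 * real n \<le> T n"
      using T_lin by (auto simp: eventually_sequentially)
    obtain m where "t / (c / 2) < real m" using reals_Archimedean2 by blast
    then have "t < c / 2 * real m" using r(3) by (simp add: field_simps)
    also have "\<dots> \<le> c / 2 * real (max m n0)" using r(3) by (intro mult_left_mono) auto
    also have "\<dots> \<le> T (max m n0)" by (intro n0) simp
    finally show ?thesis by blast
  qed
  show ?thesis
  proof (rule tendstoI)
    fix e :: real assume e: "0 < e"
    have "\<forall>\<^sub>F n in sequentially. norm (err n) < e * (c / 2)"
      using tendstoD[OF err, of "e * (c / 2)"] e r(3) by simp
    with T_lin eventually_gt_at_top[of 0] have "\<forall>\<^sub>F n in sequentially. c / 2 * real n \<le> T n \<and> 0 < n \<and> err n < e * (c / 2)"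
    proof eventually_elim
      case (elim n)
      then show ?case using abs_ge_self[of "err n"] unfolding real_norm_def by linarith
    qed
    then obtain n0 where n0: "\<And>n. n0 \<le> n \<Longrightarrow> c / 2 * real n \<le> T n \<and> 0 < n \<and> err n < e * (c / 2)"
      unfolding eventually_sequentially by blast
    show "\<forall>\<^sub>F t in at_top. dist (z t /\<^sub>R t) U < e"
      using eventually_ge_at_top[of "max 0 (T n0)"]
    proof eventually_elim
      case (elim t)
      define m where "m = (LEAST m. t < T m)"
      have m: "t < T m" unfolding m_def by (rule LeastI_ex[OF unbounded])
      then obtain n where n: "m = Suc n" using elim T0 by (cases m) auto
      have "T n \<le> t" using not_less_Least[of n "\<lambda>m. t < T m"] n by (simp add: m_def not_less)
      then have zt: "z t = y n" using m n by (intro z) auto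
      have "n0 \<le> n"
      proof (rule ccontr)
        assume "\<not> n0 \<le> n"
        then have "T m \<le> T n0" by (intro T_mono) (simp add: n)
        then show False using m elim by simp
      qed
      from n0[OF this] have *: "c / 2 * real n \<le> T n" "0 < real n" "err n < e * (c / 2)" by auto
      have "0 < c / 2 * real n" using *(2) r(3) by simp
      then have t: "0 < t" using *(1) \<open>T n \<le> t\<close> by linarith
      have "norm (z t - t *\<^sub>R U) = norm ((y n - T n *\<^sub>R U) - (t - T n) *\<^sub>R U)"
        by (simp add: zt algebra_simps)
      also have "\<dots> \<le> norm (y n - T n *\<^sub>R U) + norm ((t - T n) *\<^sub>R U)" by (rule norm_triangle_ineq4)
      also have "norm ((t - T n) *\<^sub>R U) \<le> tau n * norm U"
        using \<open>T n \<le> t\<close> m n by (simp add: T_Suc mult_right_mono)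
      also have "norm (y n - T n *\<^sub>R U) + tau n * norm U = err n * real n"
        using *(2) by (simp add: err_def distrib_right)
      also have "\<dots> < e * (c / 2) * real n" using * by (intro mult_strict_right_mono)
      also have "\<dots> = e * (c / 2 * real n)" by (rule mult.assoc)
      also have "\<dots> \<le> e * t"
        using *(1) \<open>T n \<le> t\<close> e by (intro mult_left_mono) auto
      finally have "norm (z t - t *\<^sub>R U) < e * t" by simp
      moreover have "z t /\<^sub>R t - U = (z t - t *\<^sub>R U) /\<^sub>R t" using t by (simp add: algebra_simps)
      then have "dist (z t /\<^sub>R t) U = norm (z t - t *\<^sub>R U) / t"
        using t by (simp add: dist_norm divide_inverse mult.commute)
      ultimately show ?case using t by (simp add: pos_divide_less_eq)
    qed
  qed
qed

lemma uniform_rescaled_limit: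
  fixes Z :: "real \<Rightarrow> 'w \<Rightarrow> real ^ 'd"
  assumes lim: "((\<lambda>t. Z t \<omega> /\<^sub>R t) \<longlongrightarrow> U) at_top" and t0: "0 < t0" "t0 < T"
  shows "((\<lambda>\<epsilon>. SUP t\<in>{t0..T}. ereal (norm (rescaled Z \<epsilon> t \<omega> - t *\<^sub>R U))) \<longlongrightarrow> 0) (at_right 0)"
proof (rule order_tendstoI)
  fix a :: ereal assume "a < 0"
  also have "0 \<le> (SUP t\<in>{t0..T}. ereal (norm (rescaled Z \<epsilon> t \<omega> - t *\<^sub>R U)))" for \<epsilon>
    using t0 by (intro SUP_upper2[of t0]) auto
  finally show "\<forall>\<^sub>F \<epsilon> in at_right 0. a < (SUP t\<in>{t0..T}. ereal (norm (rescaled Z \<epsilon> t \<omega> - t *\<^sub>R U)))"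
    by simp
next
  fix a :: ereal assume "0 < a"
  then obtain d where d: "0 < ereal d" "ereal d < a" using ereal_dense2 by blast
  then have "0 < d / T" using t0 by simp
  from tendstoD[OF lim this] obtain s1 where s1: "\<And>s. s1 \<le> s \<Longrightarrow> dist (Z s \<omega> /\<^sub>R s) U < d / T"
    by (auto simp: eventually_at_top_linorder)
  \<comment> \<open>A positive threshold, so that \<open>sqrt (t0 / s0)\<close> is a positive bound for \<open>\<epsilon>\<close>.\<close>
  define s0 where "s0 = max 1 s1"
  have "\<forall>\<^sub>F \<epsilon> in at_right 0. \<epsilon> < sqrt (t0 / s0)"
    unfolding eventually_at_right_field using t0 by (intro exI[of _ "sqrt (t0 / s0)"]) (auto simp: s0_def)
  moreover have "\<forall>\<^sub>F \<epsilon> in at_right (0::real). 0 < \<epsilon>" by (rule eventually_at_right_less)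
  ultimately show "\<forall>\<^sub>F \<epsilon> in at_right 0. (SUP t\<in>{t0..T}. ereal (norm (rescaled Z \<epsilon> t \<omega> - t *\<^sub>R U))) < a"
  proof eventually_elim
    case (elim \<epsilon>)
    have "\<epsilon>\<^sup>2 < (sqrt (t0 / s0))\<^sup>2" using elim by (intro power_strict_mono) auto
    also have "(sqrt (t0 / s0))\<^sup>2 = t0 / s0" using t0 by (simp add: s0_def)
    finally have "s0 * \<epsilon>\<^sup>2 < t0" by (simp add: s0_def field_simps)
    then have eps: "s0 \<le> t0 / \<epsilon>\<^sup>2" using elim by (simp add: pos_le_divide_eq)
    have "norm (rescaled Z \<epsilon> t \<omega> - t *\<^sub>R U) \<le> d" if t: "t \<in> {t0..T}" for t
    proof -
      define s where "s = t / \<epsilon>\<^sup>2"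
      have "t0 / \<epsilon>\<^sup>2 \<le> s" using t by (simp add: s_def divide_right_mono)
      then have "s1 \<le> s" using eps by (simp add: s0_def)
      have "0 < t" using t t0 by simp
      have "rescaled Z \<epsilon> t \<omega> - t *\<^sub>R U = t *\<^sub>R (Z s \<omega> /\<^sub>R s - U)"
        using elim \<open>0 < t\<close> by (simp add: rescaled_def s_def algebra_simps)
      then have "norm (rescaled Z \<epsilon> t \<omega> - t *\<^sub>R U) = t * dist (Z s \<omega> /\<^sub>R s) U"
        using \<open>0 < t\<close> by (simp add: dist_norm)
      also have "\<dots> \<le> T * (d / T)"
        using s1[OF \<open>s1 \<le> s\<close>] t \<open>0 < t\<close> by (intro mult_mono) auto
      finally show ?thesis using t0 by simp
    qed
    then have "(SUP t\<in>{t0..T}. ereal (norm (rescaled Z \<epsilon> t \<omega> - t *\<^sub>R U))) \<le> ereal d"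
      by (intro SUP_least) auto
    then show ?case using d(2) by (rule le_less_trans)
  qed
qed

section \<open>The strong law for the jump process\<close>

context periodic_graph
begin

lemma sum_successors:
  "(\<Sum>y\<in>snd ` out_edges E x. edge_rate E lam x y * g y) = (\<Sum>e\<in>out_edges E x. lam e * g (snd e))"
proof -
  have "inj_on snd (out_edges E x)" by (auto simp: inj_on_def out_edges_def prod_eq_iff)
  then have "(\<Sum>y\<in>snd ` out_edges E x. edge_rate E lam x y * g y) =
      (\<Sum>e\<in>out_edges E x. edge_rate E lam x (snd e) * g (snd e))"
    by (simp add: sum.reindex)
  also have "\<dots> = (\<Sum>e\<in>out_edges E x. lam e * g (snd e))"
    by (intro sum.cong refl) (auto simp: out_edges_def edge_rate_def)
  finally show ?thesis .
qed

lemma sum_transition_probabilities: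
  assumes "x \<in> S"
  shows "(\<Sum>y\<in>snd ` out_edges E x. edge_rate E lam x y / exit_rate E lam x) = 1"
  using sum_successors[of x "\<lambda>_. 1 / exit_rate E lam x"] exit_rate_pos[OF assms]
  by (simp add: exit_rate_def flip: sum_divide_distrib)

lemma exit_rate_bounds:
  obtains qmin qmax where "0 < qmin" "\<And>x. x \<in> S \<Longrightarrow> qmin \<le> exit_rate E lam x"
    "\<And>x. x \<in> S \<Longrightarrow> exit_rate E lam x \<le> qmax"
proof (cases "S = {}")
  case False
  let ?Q = "exit_rate E lam ` Sbar S"
  have Q: "finite ?Q" "?Q \<noteq> {}" using finite_Sbar rep_in_Sbar False by auto
  show thesis
  proof (rule that[of "Min ?Q" "Max ?Q"])
    show "0 < Min ?Q" using Q by (auto simp: Sbar_def exit_rate_pos)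
    fix x assume "x \<in> S"
    then have "exit_rate E lam x \<in> ?Q" by (subst exit_rate_rep) (intro imageI rep_in_Sbar)
    then show "Min ?Q \<le> exit_rate E lam x" "exit_rate E lam x \<le> Max ?Q" using Q by auto
  qed
qed (rule that[of 1 1]; simp)

text \<open>The corrected increment of the \<open>i\<close>-th coordinate: the displacement along the edge, plus the change of the
  corrector \<open>f\<close>, minus the asymptotic velocity times the mean holding time.\<close>

definition increment :: "(real ^ 'd \<Rightarrow> real) \<Rightarrow> 'd \<Rightarrow> real ^ 'd \<Rightarrow> real ^ 'd \<Rightarrow> real" where
  "increment f i x y = (y - x) $ i + f (rep y) - f (rep x) - Ubar S E lam $ i / exit_rate E lam x"

text \<open>The corrected increment is invariant under integer translations of both arguments, so it takes only finitely
  many values along edges.\<close>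

lemma increment_bounded:
  obtains B where "\<And>x y. x \<in> S \<Longrightarrow> y \<in> snd ` out_edges E x \<Longrightarrow> \<bar>increment f i x y\<bar> \<le> B"
proof -
  let ?g = "\<lambda>e. increment f i (fst e) (snd e)"
  have "finite ((\<lambda>e. \<bar>?g e\<bar>) ` Ebar S E)" using finite_Ebar by simp
  then obtain B where B: "\<And>e. e \<in> Ebar S E \<Longrightarrow> \<bar>?g e\<bar> \<le> B"
    using finite_has_maximal2 by (metis (no_types, lifting) Max_ge imageI)
  show thesis
  proof (rule that[of B])
    fix x y assume x: "x \<in> S" and y: "y \<in> snd ` out_edges E x"
    obtain n where n: "n \<in> int_lattice" "x = rep x + n" by (rule rep_translate)
    have xy: "(x, y) \<in> E" using y by (auto simp: out_edges_def)
    have "(x + - n, y + - n) \<in> E" by (intro E_translate int_lattice_uminus n xy)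
    moreover have xn: "x + - n = rep x" using n(2) by (metis add_diff_cancel_right' diff_conv_add_uminus)
    ultimately have "(rep x, y + - n) \<in> Ebar S E"
      using rep_in_Sbar[OF x] by (auto simp: Ebar_def out_edges_def)
    then have "\<bar>increment f i (x + - n) (y + - n)\<bar> \<le> B" using B[of "(rep x, y + - n)"] by (simp only: xn fst_conv snd_conv)
    moreover have "increment f i (x + - n) (y + - n) = increment f i x y"
      unfolding increment_def
      by (simp only: rep_add_lattice[OF int_lattice_uminus[OF n(1)]] exit_rate_rep[of "x + - n"] exit_rate_rep[of x]) simp
    ultimately show "\<bar>increment f i x y\<bar> \<le> B" by simp
  qed
qed

lemma increment_centred:
  assumes f: "\<And>y. y \<in> Sbar S \<Longrightarrow> drift E lam y $ i + gen E lam f y = Ubar S E lam $ i"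
    and x: "x \<in> S"
  shows "(\<Sum>y\<in>snd ` out_edges E x. edge_rate E lam x y / exit_rate E lam x * increment f i x y) = 0"
proof -
  let ?q = "exit_rate E lam x" and ?u = "Ubar S E lam $ i"
  have qsum: "(\<Sum>e\<in>out_edges E x. lam e * c) = ?q * c" for c
    by (simp add: exit_rate_def sum_distrib_right)
  have "(\<Sum>y\<in>snd ` out_edges E x. edge_rate E lam x y / ?q * increment f i x y) =
      (\<Sum>e\<in>out_edges E x. lam e * (increment f i x (snd e) / ?q))"
    using sum_successors[of x "\<lambda>y. increment f i x y / ?q"] by simp
  also have "\<dots> = (\<Sum>e\<in>out_edges E x. lam e * increment f i x (snd e)) / ?q"
    by (simp add: sum_divide_distrib)
  also have "(\<Sum>e\<in>out_edges E x. lam e * increment f i x (snd e)) =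
      (\<Sum>e\<in>out_edges E x. lam e * nu e $ i + (f (rep (x + nu e)) - f (rep x)) * lam e - lam e * (?u / ?q))"
    by (intro sum.cong refl) (auto simp: increment_def out_edges_def nu_def algebra_simps)
  also have "\<dots> = drift E lam x $ i + gen E lam f (rep x) - ?q * (?u / ?q)"
    by (simp add: sum.distrib sum_subtractf gen_rep_eq drift_def qsum del: times_divide_eq_right)
  also have "\<dots> = 0"
    using f[OF rep_in_Sbar[OF x]] exit_rate_pos[OF x] drift_rep[of x] by simp
  finally show ?thesis by simp
qed

theorem jump_process_strong_law:
  assumes M: "prob_space M" and Z: "markov_jump_process M S E lam x0 Z" and x0: "x0 \<in> S"
  shows "AE \<omega> in M. ((\<lambda>t. Z t \<omega> /\<^sub>R t) \<longlongrightarrow> Ubar S E lam) at_top"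
proof -
  let ?q = "exit_rate E lam" and ?U = "Ubar S E lam"
  obtain Y tau where Y: "\<And>n. Y n \<in> measurable M (count_space S)"
    and tau: "\<And>n. tau n \<in> borel_measurable M"
    and law: "\<And>n x s. x 0 = x0 \<and> (\<forall>i\<le>n. x i \<in> S \<and> 0 \<le> s i) \<longrightarrow>
           measure M {\<omega> \<in> space M. \<forall>i\<le>n. Y i \<omega> = x i \<and> s i < tau i \<omega>} =
             (\<Prod>i<n. edge_rate E lam (x i) (x (Suc i)) / ?q (x i)) * (\<Prod>i\<le>n. exp (- ?q (x i) * s i))"
    and path: "AE \<omega> in M. \<forall>n t. (\<Sum>i<n. tau i \<omega>) \<le> t \<and> t < (\<Sum>i<Suc n. tau i \<omega>) \<longrightarrow> Z t \<omega> = Y n \<omega>"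
    using Z unfolding markov_jump_process_def by blast
  obtain qmin qmax where q: "0 < qmin" "\<And>x. x \<in> S \<Longrightarrow> qmin \<le> ?q x" "\<And>x. x \<in> S \<Longrightarrow> ?q x \<le> qmax"
    using exit_rate_bounds by blast
  interpret prob_space M by (rule M)
  interpret jump_chain M S "\<lambda>x. snd ` out_edges E x" "\<lambda>x y. edge_rate E lam x y / ?q x" ?q x0 Y tau qmin
  proof
    show "snd ` out_edges E x \<subseteq> S" for x using E_subset by (auto simp: out_edges_def)
    show "finite (snd ` out_edges E x)" if "x \<in> S" for x using finite_out_edges[OF that] by simp
    show "prob {\<omega> \<in> space M. \<forall>i\<le>n. Y i \<omega> = x i \<and> s i < tau i \<omega>} =
        (\<Prod>i<n. edge_rate E lam (x i) (x (Suc i)) / ?q (x i)) * (\<Prod>i\<le>n. exp (- ?q (x i) * s i))"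
      if "x 0 = x0" "\<And>i. i \<le> n \<Longrightarrow> x i \<in> S \<and> 0 \<le> s i" for n x s
      using that by (intro law[rule_format]) auto
  qed (fact countable_S x0 q Y tau sum_transition_probabilities)+
  have "AE \<omega> in M. (\<lambda>n. (Y n \<omega> - (\<Sum>k<n. tau k \<omega>) *\<^sub>R ?U) $ i / real n) \<longlonglongrightarrow> 0" for i
  proof -
    have "S \<noteq> {}" using x0 by blast
    then obtain f where f: "\<And>y. y \<in> Sbar S \<Longrightarrow> drift E lam y $ i + gen E lam f y = ?U $ i"
      using corrector by blast
    obtain B where "\<And>x y. x \<in> S \<Longrightarrow> y \<in> snd ` out_edges E x \<Longrightarrow> \<bar>increment f i x y\<bar> \<le> B"
      using increment_bounded by blast
    then have "AE \<omega> in M. (\<lambda>n. (\<Sum>k<n. increment f i (Y k \<omega>) (Y (Suc k) \<omega>)) / real n) \<longlonglongrightarrow> 0"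
      using increment_centred[OF f] by (rule chain_strong_law)
    with holding_times_strong_law AE_space show ?thesis
    proof eventually_elim
      case (elim \<omega>)
      let ?Y = "\<lambda>n. Y n \<omega>" and ?h = "\<lambda>n. f (rep (Y n \<omega>))"
      \<comment> \<open>The mean holding times \<open>1 / ?q\<close> in the two sums cancel, which leaves the elapsed time.\<close>
      have telescope: "(?Y n - (\<Sum>k<n. tau k \<omega>) *\<^sub>R ?U) $ i =
          (\<Sum>k<n. increment f i (?Y k) (?Y (Suc k))) + ?U $ i * (\<Sum>k<n. 1 / ?q (?Y k) - tau k \<omega>)
          + ?Y 0 $ i + ?h 0 - ?h n" for n
        by (induction n) (auto simp: increment_def algebra_simps)
      obtain K where K: "\<And>y. y \<in> Sbar S \<Longrightarrow> \<bar>f y\<bar> \<le> K"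
        using finite_Sbar by (metis (no_types, lifting) Max_ge finite_imageI imageI)
      have "(\<lambda>n. ?h n / real n) \<longlonglongrightarrow> 0"
      proof (rule Lim_null_comparison[OF _ lim_const_over_n[of K]])
        show "\<forall>\<^sub>F n in sequentially. norm (?h n / real n) \<le> K / real n"
          using K rep_in_Sbar Y_in_S elim by (auto intro!: always_eventually divide_right_mono)
      qed
      then have "(\<lambda>n. (\<Sum>k<n. increment f i (?Y k) (?Y (Suc k))) / real n
          + ?U $ i * ((\<Sum>k<n. 1 / ?q (?Y k) - tau k \<omega>) / real n)
          + (?Y 0 $ i + ?h 0) / real n - ?h n / real n) \<longlonglongrightarrow> 0 + ?U $ i * 0 + 0 - 0"
        using elim by (intro tendsto_intros lim_const_over_n)
      then show ?case
        unfolding telescope by (simp add: add_divide_distrib diff_divide_distrib algebra_simps)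
    qed
  qed
  then have "AE \<omega> in M. \<forall>i\<in>UNIV. (\<lambda>n. (Y n \<omega> - (\<Sum>k<n. tau k \<omega>) *\<^sub>R ?U) $ i / real n) \<longlonglongrightarrow> 0"
    by (intro AE_finite_allI) auto
  with path holding_times_strong_law AE_chain AE_space show ?thesis
  proof eventually_elim
    case (elim \<omega>)
    have in_S: "Y n \<omega> \<in> S" for n using Y_in_S elim by blast
    show ?case
    proof (rule jump_path_asymptotics[where tau = "\<lambda>n. tau n \<omega>" and y = "\<lambda>n. Y n \<omega>"
          and r = "\<lambda>n. 1 / ?q (Y n \<omega>)" and c = "1 / qmax" and C = "1 / qmin"])
      have "0 < qmax" using q x0 by (meson less_le_trans)
      then show "0 < 1 / qmax" by simp
      show "1 / qmax \<le> 1 / ?q (Y n \<omega>)" for n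
        using q(3)[OF in_S[of n]] exit_rate_pos[OF in_S[of n]] by (simp add: frac_le)
      show "1 / ?q (Y n \<omega>) \<le> 1 / qmin" for n
        using q(1) q(2)[OF in_S[of n]] by (simp add: frac_le)
      show "(\<lambda>n. (Y n \<omega> - (\<Sum>k<n. tau k \<omega>) *\<^sub>R ?U) /\<^sub>R real n) \<longlonglongrightarrow> 0"
        using elim by (intro vec_tendstoI) (simp add: divide_inverse mult.commute)
    qed (use elim in auto)
  qed
qed

end

theorem lemma3p2:
  fixes S :: "(real ^ 'd) set" and E :: "'d edge set" and lam :: "'d edge \<Rightarrow> real"
    and M :: "'w measure" and Z :: "real \<Rightarrow> 'w \<Rightarrow> real ^ 'd" and t0 T :: real
  assumes "periodic_graph S E lam"
    and "0 \<in> S"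
    and "prob_space M"
    and "markov_jump_process M S E lam 0 Z"
    and "0 < t0" and "t0 < T"
  shows "AE \<omega> in M.
    ((\<lambda>\<epsilon>. SUP t\<in>{t0..T}. ereal (norm (rescaled Z \<epsilon> t \<omega> - t *\<^sub>R Ubar S E lam))) \<longlongrightarrow> 0) (at_right 0)"
proof -
  interpret periodic_graph S E lam by fact
  have "AE \<omega> in M. ((\<lambda>t. Z t \<omega> /\<^sub>R t) \<longlongrightarrow> Ubar S E lam) at_top"
    using assms by (intro jump_process_strong_law)
  then show ?thesis
    by eventually_elim (intro uniform_rescaled_limit assms)
qed

end
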